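(* Let $M$ be a smooth finite-dimensional manifold, $V$ a Banach space, $\mathbf y=(y,y^\dagger)\in CRP_{\mathbf X}(M)$, $\alpha\in\Omega^1(M,V)$ a smooth $V$-valued one-form, and $\phi$ a chart on $M$ with domain $D(\phi)$. Let $z$ denote the path component of $\int\alpha(d\mathbf y)$. For all $a,b\in[0,T]$ such that $y([a,b])\subset D(\phi)$, the approximation $$z_t-z_s\;\approx_3\;\alpha_{y_s}\left((d\phi_{y_s})^{-1}\left[\phi(y_t)-\phi(y_s)\right]\right)+d\left(\alpha_{(\cdot)}\circ(d\phi_{(\cdot)})^{-1}d\phi_{y_s}\right)_{y_s}\circ\left(y_s^\dagger\otimes y_s^\dagger\right)\mathbb X_{s,t}$$ holds for $s<t$ in $[a,b]$. Here the second term is the value on $(y_s^\dagger\otimes y_s^\dagger)\mathbb X_{s,t}\in T_{y_s}M\otimes T_{y_s}M$ of the linear map determined by $v\otimes w\mapsto v\left[m\mapsto\alpha_m\left((d\phi_m)^{-1}d\phi_{y_s}w\right)\right]$ (derivative at $y_s$ in direction $v$).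
   Context: Rough paths. $W=\mathbb R^k$, $T>0$, $1\le p<3$, $\Delta_{[0,T]}=\{(s,t):0\le s\le t\le T\}$. A control is a continuous $\omega:\Delta_{[0,T]}\to[0,\infty)$ with $\omega(s,s)=0$ and $\omega(s,t)+\omega(t,u)\le\omega(s,u)$ for $s\le t\le u$. $\mathbf X=(x,\mathbb X)$ is a fixed weak-geometric $p$-rough path with control $\omega$: $x:[0,T]\to W$ and $\mathbb X:\Delta_{[0,T]}\to W\otimes W$ are continuous and, with $x_{s,t}:=x_t-x_s$, one has $\mathbb X_{s,u}=\mathbb X_{s,t}+\mathbb X_{t,u}+x_{s,t}\otimes x_{t,u}$ for $s\le t\le u$, $|x_{s,t}|\le\omega(s,t)^{1/p}$, $|\mathbb X_{s,t}|\le\omega(s,t)^{2/p}$, and the symmetric part of $\mathbb X_{s,t}$ equals $\frac12x_{s,t}\otimes x_{s,t}$. $F_{s,t}\approx_iG_{s,t}$ on a time interval means: there are $C<\infty$, $\delta>0$ (with $\delta$ small enough that all expressions are defined) such that $|F_{s,t}-G_{s,t}|\le C\omega(s,t)^{i/p}$ for all $s\le t$ in that interval with $t-s\le\delta$; for values in spaces built from $T_{y_s}M$ the norm is the (operator) norm from any fixed Riemannian metric on $M$. If no interval is named it is $[0,T]$. $CRP_{\mathbf X}(V)$: continuous pairs $(z,z^\dagger)$, $z:[0,T]\to V$, $z^\dagger:[0,T]\to L(W,V)$, for which there is $C$ with $|z_t-z_s-z_s^\dagger x_{s,t}|\le C\omega(s,t)^{2/p}$ and $|z_t^\dagger-z_s^\dagger|\le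 C\omega(s,t)^{1/p}$ for all $0\le s\le t\le T$. Gauges. A diagonal domain is an open $\mathcal D\subseteq M\times M$ containing the diagonal. A logarithm is a smooth $\psi:\mathcal D\to TM$ with $\psi(m,n)\in T_mM$, $\psi(m,m)=0_m$, and differential of $\psi(m,\cdot)$ at $m$ equal to the identity of $T_mM$. A parallelism is a smooth map $(n,m)\in\mathcal D\mapsto U(n,m)\in L(T_mM,T_nM)$ with $U(m,m)=I$. A gauge is a pair $(\psi,U)$ of these with common domain $\mathcal D$. $CRP_{\mathbf X}(M)$: continuous pairs $(y,y^\dagger)$, $y:[0,T]\to M$, $y_s^\dagger\in L(W,T_{y_s}M)$, with $\psi(y_s,y_t)\approx_2y_s^\dagger x_{s,t}$ and $U(y_s,y_t)y_t^\dagger\approx_1y_s^\dagger$ (this does not depend on the gauge chosen). Covariant derivative $\nabla^U$: for a vector field $Y$ and $v\in T_mM$, $\nabla^U_vY:=\frac{d}{dt}\big|_0U(m,\sigma_t)Y(\sigma_t)$ with $\dot\sigma_0=v$; on one-forms, $v[\alpha(Y)]=(\nabla^U_v\alpha)(Y(m))+\alpha_m(\nabla^U_vY)$. Compatibility tensor of a gauge $\mathcal G=(\psi,U)$: $S_m^{\mathcal G}[v\otimes w]:=v\left[n\mapsto U(n,m)^{-1}U^\psi(n,m)w\right]$ (derivative at $m$ in direction $v$), where $U^\psi(n,m):=$ differential of $\psi(n,\cdot)$ at $m$, viewed as a map $T_mM\to T_nM$. Integral. $\int\alpha(d\mathbf y)$ is the unique $(z,z^\dagger)\in CRP_{\mathbf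 X}(V)$ with $z_0=0$, $z_s^\dagger=\alpha_{y_s}\circ y_s^\dagger$ and $z_t-z_s\approx_3\alpha_{y_s}(\psi(y_s,y_t))+\left[(\nabla^U\alpha)_{y_s}+\alpha_{y_s}\circ S^{\mathcal G}_{y_s}\right](y_s^\dagger\otimes y_s^\dagger)\mathbb X_{s,t}$, where $(\nabla^U\alpha)(v\otimes w)=(\nabla^U_v\alpha)(w)$; it exists and does not depend on the gauge $\mathcal G=(\psi,U)$. *)

theory Defs
  imports "HOL-Analysis.Analysis"
begin

section \<open>Smooth maps on open subsets of a Euclidean space\<close>

text \<open>Intended for open \<open>S\<close> and a finite-dimensional domain; there, continuity of all iterated
  directional derivatives agrees with continuity of the derivatives in operator norm.\<close>

fun Ck_on :: "nat \<Rightarrow> 'a::euclidean_space set \<Rightarrow> ('a \<Rightarrow> 'b::real_normed_vector) \<Rightarrow> bool" where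
  "Ck_on 0 S f \<longleftrightarrow> continuous_on S f"
| "Ck_on (Suc k) S f \<longleftrightarrow>
     (\<forall>x\<in>S. f differentiable (at x)) \<and> (\<forall>v. Ck_on k S (\<lambda>x. frechet_derivative f (at x) v))"

definition smooth_on :: "'a::euclidean_space set \<Rightarrow> ('a \<Rightarrow> 'b::real_normed_vector) \<Rightarrow> bool" where
  "smooth_on S f \<longleftrightarrow> (\<forall>k. Ck_on k S f)"


section \<open>Smooth manifolds\<close>

text \<open>A manifold is a Hausdorff second countable type \<open>'m\<close> together with a maximal smooth atlas
  \<open>A\<close>, modelled on a Euclidean space \<open>'e\<close>. The values of a chart outside its domain are
  irrelevant.\<close>

record ('m, 'e) chart =
  cdom :: "'m set"
  cfun :: "'m \<Rightarrow> 'e"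

definition cinv :: "('m, 'e) chart \<Rightarrow> 'e \<Rightarrow> 'm" where
  "cinv \<phi> = inv_into (cdom \<phi>) (cfun \<phi>)"

definition is_chart :: "('m::topological_space, 'e::euclidean_space) chart \<Rightarrow> bool" where
  "is_chart \<phi> \<longleftrightarrow> open (cdom \<phi>) \<and> open (cfun \<phi> ` cdom \<phi>) \<and>
     homeomorphism (cdom \<phi>) (cfun \<phi> ` cdom \<phi>) (cfun \<phi>) (cinv \<phi>)"

definition smooth_compatible ::
    "('m, 'e::euclidean_space) chart \<Rightarrow> ('m, 'e) chart \<Rightarrow> bool" where
  "smooth_compatible \<phi> \<eta> \<longleftrightarrow>
     smooth_on (cfun \<phi> ` (cdom \<phi> \<inter> cdom \<eta>)) (cfun \<eta> \<circ> cinv \<phi>) \<and>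
     smooth_on (cfun \<eta> ` (cdom \<phi> \<inter> cdom \<eta>)) (cfun \<phi> \<circ> cinv \<eta>)"

definition smooth_structure ::
    "('m::{t2_space,second_countable_topology}, 'e::euclidean_space) chart set \<Rightarrow> bool" where
  "smooth_structure A \<longleftrightarrow>
     (\<forall>\<phi>\<in>A. is_chart \<phi>) \<and> (\<Union>\<phi>\<in>A. cdom \<phi>) = UNIV \<and>
     (\<forall>\<phi>\<in>A. \<forall>\<eta>\<in>A. smooth_compatible \<phi> \<eta>) \<and>
     (\<forall>\<phi>. is_chart \<phi> \<and> (\<forall>\<eta>\<in>A. smooth_compatible \<phi> \<eta>) \<longrightarrow> \<phi> \<in> A)"

text \<open>Every tangent space \<open>T\<^sub>mM\<close> is represented by the model space \<open>'e\<close>: a vector \<open>v :: 'e\<close> stands for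
  the tangent vector at \<open>m\<close> whose coordinate vector in the reference chart \<open>tchart A m\<close> is \<open>v\<close>.
  Reference charts are chosen arbitrarily, so they do not vary continuously with \<open>m\<close>; hence smoothness
  or continuity of anything with values in spaces built from the \<open>T\<^sub>mM\<close> is always expressed
  after transport by the differentials \<open>d\<phi>\<^sub>m\<close> of charts \<open>\<phi> \<in> A\<close>. On a fixed \<open>T\<^sub>mM\<close>
  the vector space operations are those of \<open>'e\<close>.\<close>

definition tchart :: "('m, 'e) chart set \<Rightarrow> 'm \<Rightarrow> ('m, 'e) chart" where
  "tchart A m = (SOME \<phi>. \<phi> \<in> A \<and> m \<in> cdom \<phi>)"

text \<open>\<open>tderiv A f m v\<close> is the derivative \<open>v[f]\<close> at \<open>m\<close>, in direction \<open>v \<in> T\<^sub>mM\<close>, of a function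
  \<open>f\<close> defined near \<open>m\<close> with values in a fixed normed space (which may be a fixed \<open>T\<^sub>nM\<close>).
  In particular \<open>tderiv A (cfun \<phi>) m\<close> is \<open>d\<phi>\<^sub>m : T\<^sub>mM \<rightarrow> 'e\<close>.\<close>

definition tderiv ::
    "('m, 'e::euclidean_space) chart set \<Rightarrow> ('m \<Rightarrow> 'v::real_normed_vector) \<Rightarrow> 'm \<Rightarrow> 'e \<Rightarrow> 'v" where
  "tderiv A f m = frechet_derivative (f \<circ> cinv (tchart A m)) (at (cfun (tchart A m) m))"

definition smooth_vector_field_on ::
    "('m, 'e::euclidean_space) chart set \<Rightarrow> 'm set \<Rightarrow> ('m \<Rightarrow> 'e) \<Rightarrow> bool" where
  "smooth_vector_field_on A N Y \<longleftrightarrow>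
     (\<forall>\<phi>\<in>A. smooth_on (cfun \<phi> ` (cdom \<phi> \<inter> N))
        (\<lambda>x. tderiv A (cfun \<phi>) (cinv \<phi> x) (Y (cinv \<phi> x))))"

definition smooth_one_form ::
    "('m, 'e::euclidean_space) chart set \<Rightarrow> ('m \<Rightarrow> 'e \<Rightarrow>\<^sub>L 'v::real_normed_vector) \<Rightarrow> bool" where
  "smooth_one_form A \<alpha> \<longleftrightarrow>
     (\<forall>\<phi>\<in>A. \<forall>e. smooth_on (cfun \<phi> ` cdom \<phi>)
        (\<lambda>x. \<alpha> (cinv \<phi> x) (inv (tderiv A (cfun \<phi>) (cinv \<phi> x)) e)))"

definition riemannian_metric ::
    "('m, 'e::euclidean_space) chart set \<Rightarrow> ('m \<Rightarrow> 'e \<Rightarrow> 'e \<Rightarrow> real) \<Rightarrow> bool" where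
  "riemannian_metric A g \<longleftrightarrow>
     (\<forall>m. bilinear (g m) \<and> (\<forall>v w. g m v w = g m w v) \<and> (\<forall>v. v \<noteq> 0 \<longrightarrow> g m v v > 0)) \<and>
     (\<forall>\<phi>\<in>A. \<forall>e e'. smooth_on (cfun \<phi> ` cdom \<phi>)
        (\<lambda>x. g (cinv \<phi> x) (inv (tderiv A (cfun \<phi>) (cinv \<phi> x)) e)
                          (inv (tderiv A (cfun \<phi>) (cinv \<phi> x)) e')))"

definition tnorm :: "('m \<Rightarrow> 'e \<Rightarrow> 'e \<Rightarrow> real) \<Rightarrow> 'm \<Rightarrow> 'e \<Rightarrow> real" where
  "tnorm g m v = sqrt (g m v v)"

text \<open>Operator norm on \<open>L(W, T\<^sub>mM)\<close>; same shape as \<^const>\<open>onorm\<close>.\<close>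

definition top_norm ::
    "('m \<Rightarrow> 'e \<Rightarrow> 'e \<Rightarrow> real) \<Rightarrow> 'm \<Rightarrow> ('w::real_normed_vector \<Rightarrow>\<^sub>L 'e::real_normed_vector) \<Rightarrow> real" where
  "top_norm g m B = (SUP w. tnorm g m (B w) / norm w)"


section \<open>Gauges\<close>

definition diagonal_domain :: "('m::topological_space \<times> 'm) set \<Rightarrow> bool" where
  "diagonal_domain \<D> \<longleftrightarrow> open \<D> \<and> (\<forall>m. (m, m) \<in> \<D>)"

definition chart_image2 ::
    "('m \<times> 'm) set \<Rightarrow> ('m, 'e) chart \<Rightarrow> ('m, 'e) chart \<Rightarrow> ('e \<times> 'e) set" where
  "chart_image2 \<D> \<phi> \<eta> = {(cfun \<phi> m, cfun \<eta> n) | m n. m \<in> cdom \<phi> \<and> n \<in> cdom \<eta> \<and> (m, n) \<in> \<D>}"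

definition logarithm_on ::
    "('m, 'e::euclidean_space) chart set \<Rightarrow> ('m \<times> 'm) set \<Rightarrow> ('m \<Rightarrow> 'm \<Rightarrow> 'e) \<Rightarrow> bool" where
  "logarithm_on A \<D> \<psi> \<longleftrightarrow>
     (\<forall>\<phi>\<in>A. \<forall>\<eta>\<in>A. smooth_on (chart_image2 \<D> \<phi> \<eta>)
        (\<lambda>(x, x'). tderiv A (cfun \<phi>) (cinv \<phi> x) (\<psi> (cinv \<phi> x) (cinv \<eta> x')))) \<and>
     (\<forall>m. \<psi> m m = 0) \<and>
     (\<forall>m. tderiv A (\<psi> m) m = id)"

definition parallelism_on ::
    "('m, 'e::euclidean_space) chart set \<Rightarrow> ('m \<times> 'm) set \<Rightarrow> ('m \<Rightarrow> 'm \<Rightarrow> 'e \<Rightarrow>\<^sub>L 'e) \<Rightarrow> bool" where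
  "parallelism_on A \<D> U \<longleftrightarrow>
     (\<forall>\<phi>\<in>A. \<forall>\<eta>\<in>A. \<forall>e. smooth_on (chart_image2 \<D> \<phi> \<eta>)
        (\<lambda>(x, x'). tderiv A (cfun \<phi>) (cinv \<phi> x)
           (U (cinv \<phi> x) (cinv \<eta> x') (inv (tderiv A (cfun \<eta>) (cinv \<eta> x')) e)))) \<and>
     (\<forall>m. U m m = id_blinfun)"

definition gauge_on ::
    "('m::topological_space, 'e::euclidean_space) chart set \<Rightarrow> ('m \<times> 'm) set \<Rightarrow>
     ('m \<Rightarrow> 'm \<Rightarrow> 'e) \<Rightarrow> ('m \<Rightarrow> 'm \<Rightarrow> 'e \<Rightarrow>\<^sub>L 'e) \<Rightarrow> bool" where
  "gauge_on A \<D> \<psi> U \<longleftrightarrow> diagonal_domain \<D> \<and> logarithm_on A \<D> \<psi> \<and> parallelism_on A \<D> U"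

text \<open>\<open>d/dt|\<^sub>0 U(m, \<sigma>\<^sub>t) Y(\<sigma>\<^sub>t)\<close> with \<open>\<sigma>\<^sub>0 = m\<close> and velocity \<open>v\<close> at \<open>0\<close> is the derivative in
  direction \<open>v\<close> of the \<open>T\<^sub>mM\<close>-valued map \<open>n \<mapsto> U(m, n) Y(n)\<close>.\<close>

definition nabla_field ::
    "('m, 'e::euclidean_space) chart set \<Rightarrow> ('m \<Rightarrow> 'm \<Rightarrow> 'e \<Rightarrow>\<^sub>L 'e) \<Rightarrow>
     ('m \<Rightarrow> 'e) \<Rightarrow> 'm \<Rightarrow> 'e \<Rightarrow> 'e" where
  "nabla_field A U Y m v = tderiv A (\<lambda>n. U m n (Y n)) m v"

text \<open>\<open>(\<nabla>\<^sub>v\<alpha>)(w)\<close>, determined by the product rule for all vector fields \<open>Y\<close> with \<open>Y(m) = w\<close>. Fields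
  defined near \<open>m\<close> suffice since both derivatives are local.\<close>

definition nabla_form ::
    "('m::topological_space, 'e::euclidean_space) chart set \<Rightarrow> ('m \<Rightarrow> 'm \<Rightarrow> 'e \<Rightarrow>\<^sub>L 'e) \<Rightarrow>
     ('m \<Rightarrow> 'e \<Rightarrow>\<^sub>L 'v::real_normed_vector) \<Rightarrow> 'm \<Rightarrow> 'e \<Rightarrow> 'e \<Rightarrow> 'v" where
  "nabla_form A U \<alpha> m v w = (THE d. \<forall>N Y.
     open N \<and> m \<in> N \<and> smooth_vector_field_on A N Y \<and> Y m = w \<longrightarrow>
     tderiv A (\<lambda>n. \<alpha> n (Y n)) m v = d + \<alpha> m (nabla_field A U Y m v))"

definition compat_tensor ::
    "('m, 'e::euclidean_space) chart set \<Rightarrow> ('m \<Rightarrow> 'm \<Rightarrow> 'e) \<Rightarrow> ('m \<Rightarrow> 'm \<Rightarrow> 'e \<Rightarrow>\<^sub>L 'e) \<Rightarrow>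
     'm \<Rightarrow> 'e \<Rightarrow> 'e \<Rightarrow> 'e" where
  "compat_tensor A \<psi> U m v w =
     tderiv A (\<lambda>n. inv (blinfun_apply (U n m)) (tderiv A (\<psi> n) m w)) m v"


section \<open>Rough paths and controlled rough paths\<close>

text \<open>\<open>W = real ^ 'k\<close>, and \<open>W \<otimes> W\<close> is the space of matrices with Frobenius norm, the entry \<open>(i, j)\<close>
  being the coefficient of \<open>e\<^sub>i \<otimes> e\<^sub>j\<close>.\<close>

definition tensor2 :: "real ^ 'k \<Rightarrow> real ^ 'k \<Rightarrow> real ^ 'k ^ 'k" where
  "tensor2 u v = (\<chi> i j. u $ i * v $ j)"

text \<open>\<open>tensor_eval b B X\<close> is the value on \<open>(B \<otimes> B) X\<close> of the linear map determined by
  \<open>v \<otimes> w \<mapsto> b v w\<close>.\<close>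

definition tensor_eval ::
    "('e \<Rightarrow> 'e \<Rightarrow> 'v::real_vector) \<Rightarrow> ((real ^ 'k) \<Rightarrow>\<^sub>L 'e::real_normed_vector) \<Rightarrow>
     real ^ 'k ^ 'k \<Rightarrow> 'v" where
  "tensor_eval b B X = (\<Sum>i\<in>UNIV. \<Sum>j\<in>UNIV. (X $ i $ j) *\<^sub>R b (B (axis i 1)) (B (axis j 1)))"

lemma tensor_eval_tensor2:
  assumes "bilinear b"
  shows "tensor_eval b B (tensor2 u v) = b (B u) (B v)"
proof -
  have l: "linear (\<lambda>x. b x y)" and r: "linear (b x)" for x y
    using assms by (auto simp: bilinear_def)
  have e: "B w = (\<Sum>i\<in>UNIV. w $ i *\<^sub>R B (axis i 1))" for w
  proof -
    have "B w = B (\<Sum>i\<in>UNIV. w $ i *\<^sub>R axis i 1)"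
      using basis_expansion[of w] by (simp add: scalar_mult_eq_scaleR)
    then show ?thesis
      by (simp add: blinfun.sum_right blinfun.scaleR_right)
  qed
  have "b (B u) (B v) = (\<Sum>j\<in>UNIV. \<Sum>i\<in>UNIV. (u $ i * v $ j) *\<^sub>R b (B (axis i 1)) (B (axis j 1)))"
    unfolding e[of u] e[of v]
    by (simp add: linear_sum[OF l] linear_sum[OF r] linear_scale[OF l] linear_scale[OF r]
        scaleR_sum_right mult.commute)
  also have "\<dots> = tensor_eval b B (tensor2 u v)"
    unfolding tensor_eval_def tensor2_def by (subst sum.swap) simp
  finally show ?thesis ..
qed

definition simplex_upto :: "real \<Rightarrow> (real \<times> real) set" where
  "simplex_upto T = {(s, t). 0 \<le> s \<and> s \<le> t \<and> t \<le> T}"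

definition control :: "real \<Rightarrow> (real \<Rightarrow> real \<Rightarrow> real) \<Rightarrow> bool" where
  "control T \<omega> \<longleftrightarrow>
     continuous_on (simplex_upto T) (\<lambda>(s, t). \<omega> s t) \<and>
     (\<forall>(s, t)\<in>simplex_upto T. 0 \<le> \<omega> s t) \<and>
     (\<forall>s\<in>{0..T}. \<omega> s s = 0) \<and>
     (\<forall>s t u. 0 \<le> s \<and> s \<le> t \<and> t \<le> u \<and> u \<le> T \<longrightarrow> \<omega> s t + \<omega> t u \<le> \<omega> s u)"

definition weak_geometric_rough_path ::
    "real \<Rightarrow> real \<Rightarrow> (real \<Rightarrow> real \<Rightarrow> real) \<Rightarrow> (real \<Rightarrow> real ^ 'k) \<Rightarrow>
     (real \<Rightarrow> real \<Rightarrow> real ^ 'k ^ 'k) \<Rightarrow> bool" where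
  "weak_geometric_rough_path T p \<omega> x \<X> \<longleftrightarrow>
     continuous_on {0..T} x \<and>
     continuous_on (simplex_upto T) (\<lambda>(s, t). \<X> s t) \<and>
     (\<forall>s t u. 0 \<le> s \<and> s \<le> t \<and> t \<le> u \<and> u \<le> T \<longrightarrow>
        \<X> s u = \<X> s t + \<X> t u + tensor2 (x t - x s) (x u - x t)) \<and>
     (\<forall>(s, t)\<in>simplex_upto T.
        norm (x t - x s) \<le> \<omega> s t powr (1 / p) \<and>
        norm (\<X> s t) \<le> \<omega> s t powr (2 / p) \<and>
        (1 / 2) *\<^sub>R (\<X> s t + transpose (\<X> s t)) = (1 / 2) *\<^sub>R tensor2 (x t - x s) (x t - x s))"

text \<open>\<open>F \<approx>\<^sub>i G\<close> on the time interval \<open>I\<close>, where \<open>\<nu> s\<close> is the norm of the space containing the values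
  at \<open>(s, t)\<close>. The condition persists when \<open>\<delta>\<close> is decreased; so, when \<open>F\<close> and \<open>G\<close> are meaningful
  only for small \<open>t - s\<close>, one may always take \<open>\<delta>\<close> small enough for them to be so.\<close>

definition approx_on ::
    "real set \<Rightarrow> (real \<Rightarrow> real \<Rightarrow> real) \<Rightarrow> real \<Rightarrow> (real \<Rightarrow> 'a::ab_group_add \<Rightarrow> real) \<Rightarrow> nat \<Rightarrow>
     (real \<Rightarrow> real \<Rightarrow> 'a) \<Rightarrow> (real \<Rightarrow> real \<Rightarrow> 'a) \<Rightarrow> bool" where
  "approx_on I \<omega> p \<nu> i F G \<longleftrightarrow>
     (\<exists>C. \<exists>\<delta>>0. \<forall>s\<in>I. \<forall>t\<in>I. s \<le> t \<and> t - s \<le> \<delta> \<longrightarrow>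
        \<nu> s (F s t - G s t) \<le> C * \<omega> s t powr (real i / p))"

definition crp_vector ::
    "real \<Rightarrow> real \<Rightarrow> (real \<Rightarrow> real \<Rightarrow> real) \<Rightarrow> (real \<Rightarrow> real ^ 'k) \<Rightarrow>
     (real \<Rightarrow> 'v::real_normed_vector) \<Rightarrow> (real \<Rightarrow> (real ^ 'k) \<Rightarrow>\<^sub>L 'v) \<Rightarrow> bool" where
  "crp_vector T p \<omega> x z zd \<longleftrightarrow>
     continuous_on {0..T} z \<and> continuous_on {0..T} zd \<and>
     (\<exists>C. \<forall>(s, t)\<in>simplex_upto T.
        norm (z t - z s - zd s (x t - x s)) \<le> C * \<omega> s t powr (2 / p) \<and>
        norm (zd t - zd s) \<le> C * \<omega> s t powr (1 / p))"

text \<open>The last condition does not depend on the gauge or on the Riemannian metric. Both exist on every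
  manifold, so it holds for some choice if and only if it holds for all.\<close>

definition crp_manifold ::
    "('m::{t2_space,second_countable_topology}, 'e::euclidean_space) chart set \<Rightarrow>
     real \<Rightarrow> real \<Rightarrow> (real \<Rightarrow> real \<Rightarrow> real) \<Rightarrow> (real \<Rightarrow> real ^ 'k) \<Rightarrow>
     (real \<Rightarrow> 'm) \<Rightarrow> (real \<Rightarrow> (real ^ 'k) \<Rightarrow>\<^sub>L 'e) \<Rightarrow> bool" where
  "crp_manifold A T p \<omega> x y yd \<longleftrightarrow>
     continuous_on {0..T} y \<and>
     (\<forall>\<phi>\<in>A. \<forall>w. continuous_on {t \<in> {0..T}. y t \<in> cdom \<phi>} (\<lambda>t. tderiv A (cfun \<phi>) (y t) (yd t w))) \<and>
     (\<exists>\<D> \<psi> U g. gauge_on A \<D> \<psi> U \<and> riemannian_metric A g \<and>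
        approx_on {0..T} \<omega> p (\<lambda>s. tnorm g (y s)) 2
          (\<lambda>s t. \<psi> (y s) (y t)) (\<lambda>s t. yd s (x t - x s)) \<and>
        approx_on {0..T} \<omega> p (\<lambda>s. top_norm g (y s)) 1
          (\<lambda>s t. U (y s) (y t) o\<^sub>L yd t) (\<lambda>s t. yd s))"

text \<open>\<open>(z, zd)\<close> is the integral of \<open>\<alpha>\<close> along \<open>(y, yd)\<close>, which exists and is unique on \<open>[0, T]\<close>.
  Again the choice of the gauge is immaterial.\<close>

definition has_rough_integral ::
    "('m::{t2_space,second_countable_topology}, 'e::euclidean_space) chart set \<Rightarrow>
     real \<Rightarrow> real \<Rightarrow> (real \<Rightarrow> real \<Rightarrow> real) \<Rightarrow> (real \<Rightarrow> real ^ 'k) \<Rightarrow> (real \<Rightarrow> real \<Rightarrow> real ^ 'k ^ 'k) \<Rightarrow>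
     (real \<Rightarrow> 'm) \<Rightarrow> (real \<Rightarrow> (real ^ 'k) \<Rightarrow>\<^sub>L 'e) \<Rightarrow> ('m \<Rightarrow> 'e \<Rightarrow>\<^sub>L 'v::banach) \<Rightarrow>
     (real \<Rightarrow> 'v) \<Rightarrow> (real \<Rightarrow> (real ^ 'k) \<Rightarrow>\<^sub>L 'v) \<Rightarrow> bool" where
  "has_rough_integral A T p \<omega> x \<X> y yd \<alpha> z zd \<longleftrightarrow>
     crp_vector T p \<omega> x z zd \<and> z 0 = 0 \<and>
     (\<forall>s\<in>{0..T}. zd s = \<alpha> (y s) o\<^sub>L yd s) \<and>
     (\<exists>\<D> \<psi> U. gauge_on A \<D> \<psi> U \<and>
        approx_on {0..T} \<omega> p (\<lambda>s. norm) 3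
          (\<lambda>s t. z t - z s)
          (\<lambda>s t. \<alpha> (y s) (\<psi> (y s) (y t)) +
             tensor_eval (\<lambda>v w. nabla_form A U \<alpha> (y s) v w + \<alpha> (y s) (compat_tensor A \<psi> U (y s) v w))
               (yd s) (\<X> s t)))"

end

theory Submission
  imports Defs
begin

text \<open>In the chart, let \<open>Q\<close> be the second derivative of the logarithm in its second argument, at the diagonal.
  The derivatives of the parallelism occurring in \<open>\<nabla>\<^sup>U\<alpha>\<close> and in the compatibility tensor cancel, and
  differentiating \<open>\<partial>\<^sub>2\<psi> = I\<close> along the diagonal turns the mixed second derivative of the logarithm into \<open>-Q\<close>. So
  the integral expansion exceeds the claimed one by \<open>\<alpha>\<close> of
  \<open>\<psi>(y\<^sub>s, y\<^sub>t) - h - Q\<close> evaluated at the second level of the rough path, where \<open>h = \<phi>(y\<^sub>t) - \<phi>(y\<^sub>s)\<close>.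
  As \<open>Q\<close> is symmetric, only the symmetric part of the second level contributes, which by weak geometricity is
  \<open>1/2 x \<otimes> x\<close>; hence this is the second order Taylor remainder of the logarithm, up to replacing
  \<open>h\<close> by \<open>y\<^sup>\<dagger> x\<close>.\<close>

section \<open>Calculus of smooth maps\<close>

text \<open>The gauges in the definitions of the integral and of a controlled path are both
  existentially quantified and need not agree. Independence of the gauge is not invoked: the gauge
  of the integral supplies the third order expansion, while that of the path serves only to bound
  coordinate increments, and those bounds no longer mention a gauge. Write
  \<open>k = dc (y s) (yd s (x t - x s))\<close> and \<open>q\<close> for \<open>\<omega>\<close> to
  the power 1/p. The delicate input is \<open>h - k = O(q^2)\<close>. Given is
  \<open>\<psi> - k = O(q^2)\<close> in a Riemannian norm; this first yields
  \<open>h = O(q)\<close>, and only then \<open>h - \<psi> = O(h^2) = O(q^2)\<close>. Reference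
  charts of the tangent spaces vary arbitrarily with the point, so bounds are taken after transport
  to the chart; they are uniform because y([a,b]) is compact. Families of linear maps are
  differentiated through their values on fixed vectors and a basis expansion, matching the way
  smoothness of forms, parallelisms and metrics is encoded.\<close>

abbreviation dir :: "('a::euclidean_space \<Rightarrow> 'b::real_normed_vector) \<Rightarrow> 'a \<Rightarrow> 'a \<Rightarrow> 'b" where
  "dir f v \<equiv> (\<lambda>x. frechet_derivative f (at x) v)"

section \<open>Closure properties of iterated differentiability\<close>

lemma Ck_on_imp_continuous_on: "Ck_on k S f \<Longrightarrow> continuous_on S f"
  by (cases k) (auto intro!: differentiable_imp_continuous_on
      simp: differentiable_on_def differentiable_at_withinI)

lemma Ck_on_mono: "Ck_on k S f \<Longrightarrow> j \<le> k \<Longrightarrow> Ck_on j S f"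
proof (induction k arbitrary: f j)
  case (Suc k)
  show ?case
  proof (cases j)
    case 0
    then show ?thesis using Suc.prems Ck_on_imp_continuous_on by (metis Ck_on.simps(1))
  next
    case (Suc i)
    then show ?thesis using Suc.prems Suc.IH by auto
  qed
qed auto

text \<open>Derivatives at a point depend only on values nearby, and openness turns agreement on
  \<open>S\<close> into agreement near each of its points. The closure properties below need this
  because a differentiation rule identifies a directional derivative with its formula on
  \<open>S\<close> only.\<close>

lemma Ck_on_cong:
  assumes "open S" "\<And>x. x \<in> S \<Longrightarrow> f x = g x" "Ck_on k S f"
  shows "Ck_on k S g"
  using assms(2,3)
proof (induction k arbitrary: f g)
  case 0
  then show ?case using continuous_on_cong by (metis Ck_on.simps(1))
next
  case (Suc k)
  have D: "(g has_derivative frechet_derivative f (at x)) (at x)" if "x \<in> S" for x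
    using Suc.prems that frechet_derivative_works has_derivative_transform_within_open[OF _ \<open>open S\<close> that]
    by (metis Ck_on.simps(2))
  then have "dir f v x = dir g v x" if "x \<in> S" for x v
    using that frechet_derivative_at by metis
  then have "Ck_on k S (dir g v)" for v
    using Suc.IH[of "dir f v" "dir g v"] Suc.prems by auto
  then show ?case using D by (auto simp: differentiable_def)
qed

lemma Ck_on_Suc_has_derivative:
  "Ck_on (Suc k) S f \<Longrightarrow> x \<in> S \<Longrightarrow> (f has_derivative frechet_derivative f (at x)) (at x)"
  by (simp add: frechet_derivative_works[symmetric])

lemma Ck_on_const: "Ck_on k S (\<lambda>x. c)"
  by (induction k arbitrary: c) auto

lemma Ck_on_add:
  assumes "open S" "Ck_on k S f" "Ck_on k S g"
  shows "Ck_on k S (\<lambda>x. f x + g x)"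
  using assms(2,3)
proof (induction k arbitrary: f g)
  case 0
  then show ?case by (auto intro: continuous_intros)
next
  case (Suc k)
  have D: "((\<lambda>x. f x + g x) has_derivative (\<lambda>v. dir f v x + dir g v x)) (at x)" if "x \<in> S" for x
    using that Suc.prems[THEN Ck_on_Suc_has_derivative] by (intro has_derivative_add) auto
  have "Ck_on k S (dir (\<lambda>x. f x + g x) v)" for v
  proof (rule Ck_on_cong[OF \<open>open S\<close>])
    show "Ck_on k S (\<lambda>x. dir f v x + dir g v x)" using Suc by auto
    fix x assume "x \<in> S"
    from frechet_derivative_at[OF D[OF this]]
    show "dir f v x + dir g v x = dir (\<lambda>x. f x + g x) v x" by metis
  qed
  then show ?case using Suc.prems by auto
qed

lemma Ck_on_sum:
  assumes "open S" "\<And>i. i \<in> I \<Longrightarrow> Ck_on k S (f i)"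
  shows "Ck_on k S (\<lambda>x. \<Sum>i\<in>I. f i x)"
  using assms(2)
  by (induction I rule: infinite_finite_induct) (auto intro: Ck_on_const Ck_on_add[OF \<open>open S\<close>])

lemma Ck_on_inner:
  assumes "open S" "Ck_on k S f"
  shows "Ck_on k S (\<lambda>x. f x \<bullet> b)"
  using assms(2)
proof (induction k arbitrary: f)
  case 0
  then show ?case by (auto intro: continuous_intros)
next
  case (Suc k)
  have D: "((\<lambda>x. f x \<bullet> b) has_derivative (\<lambda>v. dir f v x \<bullet> b)) (at x)" if "x \<in> S" for x
    using Ck_on_Suc_has_derivative[OF Suc.prems that] by (rule has_derivative_inner_left)
  have "Ck_on k S (dir (\<lambda>x. f x \<bullet> b) v)" for v
  proof (rule Ck_on_cong[OF \<open>open S\<close>])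
    show "Ck_on k S (\<lambda>x. dir f v x \<bullet> b)" using Suc by auto
    fix x assume "x \<in> S"
    from frechet_derivative_at[OF D[OF this]]
    show "dir f v x \<bullet> b = dir (\<lambda>x. f x \<bullet> b) v x" by metis
  qed
  then show ?case using D by (auto simp: differentiable_def)
qed

lemma Ck_on_scaleR:
  fixes f :: "'a::euclidean_space \<Rightarrow> real"
  assumes "open S" "Ck_on k S f" "Ck_on k S g"
  shows "Ck_on k S (\<lambda>x. f x *\<^sub>R g x)"
  using assms(2,3)
proof (induction k arbitrary: f g)
  case 0
  then show ?case by (auto intro: continuous_intros)
next
  case (Suc k)
  have D: "((\<lambda>x. f x *\<^sub>R g x) has_derivative (\<lambda>v. f x *\<^sub>R dir g v x + dir f v x *\<^sub>R g x)) (at x)"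
    if "x \<in> S" for x
    using that Suc.prems[THEN Ck_on_Suc_has_derivative] by (intro has_derivative_scaleR) auto
  have "Ck_on k S (dir (\<lambda>x. f x *\<^sub>R g x) v)" for v
  proof (rule Ck_on_cong[OF \<open>open S\<close>])
    show "Ck_on k S (\<lambda>x. f x *\<^sub>R dir g v x + dir f v x *\<^sub>R g x)"
      using Suc.prems Ck_on_mono[of "Suc k" S f k] Ck_on_mono[of "Suc k" S g k]
      by (intro Ck_on_add Suc.IH assms(1)) auto
    fix x assume "x \<in> S"
    from frechet_derivative_at[OF D[OF this]]
    show "f x *\<^sub>R dir g v x + dir f v x *\<^sub>R g x = dir (\<lambda>x. f x *\<^sub>R g x) v x" by metis
  qed
  then show ?case using D by (auto simp: differentiable_def)
qed

lemma linear_basis_expansion: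
  fixes f :: "'a::euclidean_space \<Rightarrow> 'b::real_vector"
  assumes "linear f"
  shows "f v = (\<Sum>b\<in>Basis. (v \<bullet> b) *\<^sub>R f b)"
  by (metis (no_types, lifting) assms euclidean_representation linear_scale linear_sum sum.cong)

text \<open>The chain rule gives \<open>dir f (dir g v x) (g x)\<close>, whose direction moves with
  \<open>x\<close>, whereas the induction hypothesis speaks of fixed directions. Expanding the
  moving direction in the basis leaves fixed directional derivatives of \<open>f\<close> composed
  with \<open>g\<close>, multiplied by real coefficients.\<close>

lemma Ck_on_compose:
  fixes f :: "'b::euclidean_space \<Rightarrow> 'c::real_normed_vector"
  assumes "open S" "Ck_on k R f" "Ck_on k S g" "g ` S \<subseteq> R"
  shows "Ck_on k S (f \<circ> g)"
  using assms(2,3,4)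
proof (induction k arbitrary: f g)
  case 0
  then show ?case using continuous_on_compose[of S g f] continuous_on_subset[of R f "g ` S"] by auto
next
  case (Suc k)
  have D: "((f \<circ> g) has_derivative (\<lambda>v. dir f (dir g v x) (g x))) (at x)" if "x \<in> S" for x
    using diff_chain_at[OF Ck_on_Suc_has_derivative[OF Suc.prems(2) that] Ck_on_Suc_has_derivative[OF Suc.prems(1)]]
      that Suc.prems(3) by (auto simp: o_def)
  have "Ck_on k S (dir (f \<circ> g) v)" for v
  proof (rule Ck_on_cong[OF \<open>open S\<close>])
    show "Ck_on k S (\<lambda>x. \<Sum>b\<in>Basis. (dir g v x \<bullet> b) *\<^sub>R (dir f b \<circ> g) x)"
      using Suc.prems Ck_on_mono[of "Suc k" S g k]
      by (intro Ck_on_sum Ck_on_scaleR Ck_on_inner Suc.IH assms(1)) auto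
    fix x assume x: "x \<in> S"
    from frechet_derivative_at[OF D[OF this]]
    have "dir (f \<circ> g) v x = dir f (dir g v x) (g x)" by metis
    also have "\<dots> = (\<Sum>b\<in>Basis. (dir g v x \<bullet> b) *\<^sub>R (dir f b \<circ> g) x)"
      using Suc.prems x linear_basis_expansion[OF linear_frechet_derivative[of f "at (g x)"]]
      by auto
    finally show "(\<Sum>b\<in>Basis. (dir g v x \<bullet> b) *\<^sub>R (dir f b \<circ> g) x) = dir (f \<circ> g) v x" ..
  qed
  moreover have "\<forall>x\<in>S. (f \<circ> g) differentiable (at x)" using D unfolding differentiable_def by blast
  ultimately show ?case unfolding Ck_on.simps by blast
qed

lemma smooth_on_differentiable: "smooth_on S f \<Longrightarrow> x \<in> S \<Longrightarrow> f differentiable (at x)"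
  unfolding smooth_on_def by (meson Ck_on.simps(2))

lemma smooth_on_has_derivative:
  "smooth_on S f \<Longrightarrow> x \<in> S \<Longrightarrow> (f has_derivative frechet_derivative f (at x)) (at x)"
  using smooth_on_differentiable frechet_derivative_works by blast

lemma smooth_on_dir: "smooth_on S f \<Longrightarrow> smooth_on S (dir f v)"
  unfolding smooth_on_def using Ck_on.simps(2) by blast

lemma smooth_on_continuous_on: "smooth_on S f \<Longrightarrow> continuous_on S f"
  unfolding smooth_on_def by (meson Ck_on.simps(1))

lemma smooth_on_cong:
  "open S \<Longrightarrow> (\<And>x. x \<in> S \<Longrightarrow> f x = g x) \<Longrightarrow> smooth_on S f \<Longrightarrow> smooth_on S g"
  unfolding smooth_on_def using Ck_on_cong by metis

lemma smooth_on_compose: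
  fixes f :: "'b::euclidean_space \<Rightarrow> 'c::real_normed_vector"
  assumes "open S" "smooth_on R f" "smooth_on S g" "g ` S \<subseteq> R"
  shows "smooth_on S (f \<circ> g)"
  using assms Ck_on_compose unfolding smooth_on_def by blast

lemma smooth_on_linear_dir:
  "smooth_on S f \<Longrightarrow> x \<in> S \<Longrightarrow> linear (\<lambda>v. dir f v x)"
  using linear_frechet_derivative[OF smooth_on_differentiable, of S f x] by simp

section \<open>Basis expansion of iterated derivatives and uniform bounds on compact sets\<close>

lemma smooth_on_dir_expansion:
  assumes "smooth_on S f" "x \<in> S"
  shows "dir f v x = (\<Sum>b\<in>Basis. (v \<bullet> b) *\<^sub>R dir f b x)"
  using linear_basis_expansion[OF smooth_on_linear_dir[OF assms]] .

text \<open>Linearity in the inner direction does not come from the outer derivative: it results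
  from differentiating the expansion of \<open>dir f v\<close>, which is valid on the whole open
  set.\<close>

lemma dir_dir_expansion:
  assumes S: "open S" "smooth_on S f" "x \<in> S"
  shows "dir (dir f v) u x = (\<Sum>b\<in>Basis. (v \<bullet> b) *\<^sub>R dir (dir f b) u x)"
proof -
  have D: "((\<lambda>y. \<Sum>b\<in>Basis. (v \<bullet> b) *\<^sub>R dir f b y) has_derivative
      (\<lambda>u. \<Sum>b\<in>Basis. (v \<bullet> b) *\<^sub>R dir (dir f b) u x)) (at x)"
    using smooth_on_has_derivative[OF smooth_on_dir[OF S(2)] S(3)]
    by (auto intro!: derivative_eq_intros)
  have "((dir f v) has_derivative
      (\<lambda>u. \<Sum>b\<in>Basis. (v \<bullet> b) *\<^sub>R dir (dir f b) u x)) (at x)"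
    by (rule has_derivative_transform_within_open[OF D S(1,3)])
      (rule smooth_on_dir_expansion[OF S(2), symmetric])
  from fun_cong[OF frechet_derivative_at[OF this], of u] show ?thesis by (rule sym)
qed

lemma dir_dir_bilinear:
  assumes S: "open S" "smooth_on S f" "x \<in> S"
  shows "bilinear (\<lambda>u v. dir (dir f v) u x)"
  unfolding bilinear_def
proof safe
  fix u
  have "linear (\<lambda>v. \<Sum>b\<in>Basis. (v \<bullet> b) *\<^sub>R dir (dir f b) u x)"
    by (rule linearI) (auto simp: algebra_simps scaleR_sum_right sum.distrib)
  also have "(\<lambda>v. \<Sum>b\<in>Basis. (v \<bullet> b) *\<^sub>R dir (dir f b) u x) = (\<lambda>v. dir (dir f v) u x)"
    by (intro ext) (rule dir_dir_expansion[OF S, symmetric])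
  finally show "linear (\<lambda>v. dir (dir f v) u x)" .
next
  fix v show "linear (\<lambda>u. dir (dir f v) u x)"
    by (rule smooth_on_linear_dir[OF smooth_on_dir[OF S(2)] S(3)])
qed

lemma dir_dir_dir_expansion:
  assumes S: "open S" "smooth_on S f" "x \<in> S"
  shows "dir (dir (dir f w) v) u x = (\<Sum>b\<in>Basis. (w \<bullet> b) *\<^sub>R dir (dir (dir f b) v) u x)"
proof -
  have D: "((\<lambda>y. \<Sum>b\<in>Basis. (w \<bullet> b) *\<^sub>R dir (dir f b) v y) has_derivative
      (\<lambda>u. \<Sum>b\<in>Basis. (w \<bullet> b) *\<^sub>R dir (dir (dir f b) v) u x)) (at x)"
    using smooth_on_has_derivative[OF smooth_on_dir[OF smooth_on_dir[OF S(2)]] S(3)]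
    by (auto intro!: derivative_eq_intros)
  have "((dir (dir f w) v) has_derivative
      (\<lambda>u. \<Sum>b\<in>Basis. (w \<bullet> b) *\<^sub>R dir (dir (dir f b) v) u x)) (at x)"
    by (rule has_derivative_transform_within_open[OF D S(1,3)])
      (rule dir_dir_expansion[OF S(1,2), where v = w and u = v, symmetric])
  from fun_cong[OF frechet_derivative_at[OF this], of u] show ?thesis by (rule sym)
qed

lemma norm_basis_sum_le:
  fixes v :: "'a::euclidean_space"
  assumes "\<And>b. b \<in> Basis \<Longrightarrow> norm (g b) \<le> C b"
  shows "norm (\<Sum>b\<in>Basis. (v \<bullet> b) *\<^sub>R g b) \<le> (\<Sum>b\<in>Basis. C b) * norm v"
proof -
  have "norm ((v \<bullet> b) *\<^sub>R g b) \<le> C b * norm v" if "b \<in> Basis" for b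
    using mult_mono[OF Basis_le_norm[OF that, of v] assms[OF that]] by (simp add: mult.commute)
  then have "norm (\<Sum>b\<in>Basis. (v \<bullet> b) *\<^sub>R g b) \<le> (\<Sum>b\<in>Basis. C b * norm v)"
    by (intro sum_norm_le) auto
  then show ?thesis by (simp add: sum_distrib_right)
qed

text \<open>Finitely many basis vectors turn boundedness on each of them into a uniform operator
  bound. The index set carries no structure, so the lemma serves points of a chart as well as times
  along the path.\<close>

lemma bound_linear_family:
  fixes F :: "'x \<Rightarrow> 'a::euclidean_space \<Rightarrow> 'b::real_normed_vector"
  assumes "\<And>x. x \<in> K \<Longrightarrow> linear (F x)" and "\<And>b. b \<in> Basis \<Longrightarrow> bounded ((\<lambda>x. F x b) ` K)"
  shows "\<exists>C\<ge>0. \<forall>x\<in>K. \<forall>v. norm (F x v) \<le> C * norm v"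
proof -
  obtain c where c: "\<And>b x. b \<in> Basis \<Longrightarrow> x \<in> K \<Longrightarrow> norm (F x b) \<le> c b"
    using assms(2) unfolding bounded_iff by (metis (no_types, lifting) imageI)
  have "norm (F x v) \<le> (\<Sum>b\<in>Basis. \<bar>c b\<bar>) * norm v" if "x \<in> K" for x v
    using c[OF _ that] norm_basis_sum_le[of "F x" "\<lambda>b. \<bar>c b\<bar>" v] linear_basis_expansion[OF assms(1)[OF that], of v]
    by (smt (verit, ccfv_SIG))
  then show ?thesis by (intro exI[of _ "\<Sum>b\<in>Basis. \<bar>c b\<bar>"]) (auto intro: sum_nonneg)
qed

text \<open>For each inner basis direction, continuity in \<open>x\<close> for fixed
  \<open>u\<close> suffices by \<open>bound_linear_family\<close>; summing over the basis then
  handles a general inner direction. \<open>dir3_bound\<close> adds one more direction in the same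
  way.\<close>

lemma dir2_bound:
  assumes S: "open S" "smooth_on S f" "compact K" "K \<subseteq> S"
  shows "\<exists>C\<ge>0. \<forall>x\<in>K. \<forall>u v. norm (dir (dir f v) u x) \<le> C * norm u * norm v"
proof -
  have "\<exists>C\<ge>0. \<forall>x\<in>K. \<forall>u. norm (dir (dir f b) u x) \<le> C * norm u" for b
    using S by (intro bound_linear_family)
      (auto intro!: smooth_on_linear_dir smooth_on_dir compact_imp_bounded compact_continuous_image
        continuous_on_subset[OF smooth_on_continuous_on])
  then obtain C where C: "\<And>b. C b \<ge> 0"
    "\<And>b x u. x \<in> K \<Longrightarrow> norm (dir (dir f b) u x) \<le> C b * norm u" by metis
  have "norm (dir (dir f v) u x) \<le> (\<Sum>b\<in>Basis. C b) * norm u * norm v" if "x \<in> K" for v u x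
    using norm_basis_sum_le[of "\<lambda>b. dir (dir f b) u x" "\<lambda>b. C b * norm u" v] C(2)[OF that]
      dir_dir_expansion[OF S(1,2), where x = x and v = v and u = u] that S(4)
    by (auto simp: sum_distrib_right)
  then show ?thesis by (intro exI[of _ "\<Sum>b\<in>Basis. C b"]) (auto intro!: sum_nonneg C)
qed

lemma dir3_bound:
  assumes S: "open S" "smooth_on S f" "compact K" "K \<subseteq> S"
  shows "\<exists>C\<ge>0. \<forall>x\<in>K. \<forall>u v w. norm (dir (dir (dir f w) v) u x) \<le> C * norm u * norm v * norm w"
proof -
  have "\<exists>C\<ge>0. \<forall>x\<in>K. \<forall>u v. norm (dir (dir (dir f b) v) u x) \<le> C * norm u * norm v" for b
    by (rule dir2_bound[OF S(1) smooth_on_dir[OF S(2)] S(3,4)])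
  then obtain C where C: "\<And>b. C b \<ge> 0"
    "\<And>b x u v. x \<in> K \<Longrightarrow> norm (dir (dir (dir f b) v) u x) \<le> C b * norm u * norm v" by metis
  have "norm (dir (dir (dir f w) v) u x) \<le> (\<Sum>b\<in>Basis. C b) * norm u * norm v * norm w"
    if "x \<in> K" for w v u x
    using norm_basis_sum_le[of "\<lambda>b. dir (dir (dir f b) v) u x" "\<lambda>b. C b * norm u * norm v" w] C(2)[OF that]
      dir_dir_dir_expansion[OF S(1,2), where x = x and w = w and v = v and u = u] that S(4)
    by (auto simp: sum_distrib_right)
  then show ?thesis by (intro exI[of _ "\<Sum>b\<in>Basis. C b"]) (auto intro!: sum_nonneg C)
qed

section \<open>Mean value estimates, Taylor's formula and symmetry of second derivatives\<close>

lemma norm_increment_le: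
  fixes e :: "real \<Rightarrow> 'b::real_normed_vector"
  assumes "\<And>t. 0 \<le> t \<Longrightarrow> t \<le> h \<Longrightarrow> (e has_derivative (\<lambda>k. k *\<^sub>R e' t)) (at t)"
    and "\<And>t. 0 \<le> t \<Longrightarrow> t \<le> h \<Longrightarrow> norm (e' t) \<le> M" and "0 \<le> h"
  shows "norm (e h - e 0) \<le> M * h"
proof -
  have "norm (e h - e 0) \<le> M * norm (h - 0)"
  proof (rule differentiable_bound[of "{0..h}" e "\<lambda>t k. k *\<^sub>R e' t"])
    fix t assume t: "t \<in> {0..h}"
    then show "(e has_derivative (\<lambda>k. k *\<^sub>R e' t)) (at t within {0..h})"
      using assms(1)[of t] by (auto intro: has_derivative_at_withinI)
    show "onorm (\<lambda>k. k *\<^sub>R e' t) \<le> M"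
      using t assms(2)[of t] by (intro onorm_le) (auto simp: mult.commute[of M] mult_left_mono)
  qed (use assms(3) in auto)
  then show ?thesis using assms(3) by simp
qed

lemma has_derivative_along_line:
  assumes "smooth_on S f" "z + t *\<^sub>R w \<in> S"
  shows "((\<lambda>t. f (z + t *\<^sub>R w)) has_derivative (\<lambda>k. k *\<^sub>R dir f w (z + t *\<^sub>R w))) (at t)"
proof -
  have "((\<lambda>t. z + t *\<^sub>R w) has_derivative (\<lambda>k. k *\<^sub>R w)) (at t)"
    by (auto intro!: derivative_eq_intros)
  from has_derivative_compose[OF this smooth_on_has_derivative[OF assms]]
  show ?thesis
    by (simp add: linear_scale[OF smooth_on_linear_dir[OF assms]])
qed

text \<open>The target is a normed space, so the remainder is estimated by three applications of the
  mean value inequality. Dropping the powers of \<open>t \<le> 1\<close> gives \<open>M\<close> in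
  place of the sharp \<open>M / 6\<close>; only the order matters later.\<close>

lemma taylor_second_order:
  fixes f :: "'a::euclidean_space \<Rightarrow> 'b::real_normed_vector"
  assumes S: "smooth_on S f" and seg: "\<And>t. 0 \<le> t \<Longrightarrow> t \<le> 1 \<Longrightarrow> z + t *\<^sub>R w \<in> S"
    and M: "\<And>t. 0 \<le> t \<Longrightarrow> t \<le> 1 \<Longrightarrow> norm (dir (dir (dir f w) w) w (z + t *\<^sub>R w)) \<le> M"
  shows "norm (f (z + w) - f z - dir f w z - (1/2) *\<^sub>R dir (dir f w) w z) \<le> M"
proof -
  let ?d1 = "\<lambda>t. dir f w (z + t *\<^sub>R w)"
  let ?d2 = "\<lambda>t. dir (dir f w) w (z + t *\<^sub>R w)"
  have D2: "(?d2 has_derivative (\<lambda>k. k *\<^sub>R dir (dir (dir f w) w) w (z + t *\<^sub>R w))) (at t)"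
    if "0 \<le> t" "t \<le> 1" for t
    by (rule has_derivative_along_line[OF smooth_on_dir[OF smooth_on_dir[OF S]] seg[OF that]])
  have D1: "(?d1 has_derivative (\<lambda>k. k *\<^sub>R ?d2 t)) (at t)" if "0 \<le> t" "t \<le> 1" for t
    by (rule has_derivative_along_line[OF smooth_on_dir[OF S] seg[OF that]])
  have D0: "((\<lambda>t. f (z + t *\<^sub>R w)) has_derivative (\<lambda>k. k *\<^sub>R ?d1 t)) (at t)" if "0 \<le> t" "t \<le> 1" for t
    by (rule has_derivative_along_line[OF S seg[OF that]])
  have M0: "0 \<le> M" by (rule order_trans[OF norm_ge_zero M[of 0]]) auto
  have 2: "norm (?d2 t - ?d2 0) \<le> M" if t: "0 \<le> t" "t \<le> 1" for t
  proof -
    have "norm (?d2 t - ?d2 0) \<le> M * t"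
    proof (rule norm_increment_le[where e = ?d2 and e' = "\<lambda>t. dir (dir (dir f w) w) w (z + t *\<^sub>R w)"])
      fix s assume s: "0 \<le> s" "s \<le> t"
      show "(?d2 has_derivative (\<lambda>k. k *\<^sub>R dir (dir (dir f w) w) w (z + s *\<^sub>R w))) (at s)"
        by (rule D2) (use s t in auto)
      show "norm (dir (dir (dir f w) w) w (z + s *\<^sub>R w)) \<le> M" by (rule M) (use s t in auto)
    qed (rule t)
    also have "\<dots> \<le> M" using t M0 by (simp add: mult_left_le)
    finally show ?thesis .
  qed
  \<comment> \<open>\<open>?e1\<close> is built so that its velocity is
    \<open>?d2 t - ?d2 0\<close>, already bounded by \<open>M\<close>; \<open>?e0\<close> below is
    built so that its velocity is \<open>?e1 t - ?e1 0\<close>.\<close>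
  let ?e1 = "\<lambda>t. ?d1 t - t *\<^sub>R ?d2 0"
  have 1: "norm (?e1 t - ?e1 0) \<le> M" if t: "0 \<le> t" "t \<le> 1" for t
  proof -
    have "norm (?e1 t - ?e1 0) \<le> M * t"
    proof (rule norm_increment_le[where e = ?e1 and e' = "\<lambda>t. ?d2 t - ?d2 0"])
      fix s assume s: "0 \<le> s" "s \<le> t"
      show "(?e1 has_derivative (\<lambda>k. k *\<^sub>R (?d2 s - ?d2 0))) (at s)"
        by (rule derivative_eq_intros D1 refl | use s t in \<open>simp add: algebra_simps\<close>)+
    qed (use 2 t in auto)
    also have "\<dots> \<le> M" using t M0 by (simp add: mult_left_le)
    finally show ?thesis .
  qed
  let ?e0 = "\<lambda>t. f (z + t *\<^sub>R w) - t *\<^sub>R ?d1 0 - (t\<^sup>2 / 2) *\<^sub>R ?d2 0"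
  have "norm (?e0 1 - ?e0 0) \<le> M * 1"
  proof (rule norm_increment_le[where e = ?e0 and e' = "\<lambda>t. ?e1 t - ?e1 0"])
    fix s :: real assume s: "0 \<le> s" "s \<le> 1"
    have "((\<lambda>t::real. t\<^sup>2 / 2) has_derivative (\<lambda>k. k * s)) (at s)"
      by (auto intro!: derivative_eq_intros simp: field_simps)
    then show "(?e0 has_derivative (\<lambda>k. k *\<^sub>R (?e1 s - ?e1 0))) (at s)"
      by - (rule derivative_eq_intros D0 refl | assumption | use s in \<open>simp add: algebra_simps\<close>)+
  qed (use 1 in auto)
  then show ?thesis by (simp add: algebra_simps)
qed

text \<open>Mean value inequality twice, in direction \<open>u\<close> and then in direction
  \<open>v\<close>, over a parallelogram on which the mixed derivative differs from its value at
  \<open>z\<close> by at most \<open>\<epsilon>\<close>.\<close>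

lemma second_difference:
  fixes f :: "'a::euclidean_space \<Rightarrow> 'b::real_normed_vector"
  assumes S: "open S" "smooth_on S f" "z \<in> S" and "0 < \<epsilon>"
  shows "\<exists>d>0. \<forall>h. 0 < h \<and> h < d \<longrightarrow>
    norm (f (z + h *\<^sub>R v + h *\<^sub>R u) - f (z + h *\<^sub>R u) - f (z + h *\<^sub>R v) + f z - (h * h) *\<^sub>R dir (dir f u) v z)
      \<le> \<epsilon> * (h * h)"
proof -
  let ?g = "dir (dir f u) v"
  have "isCont ?g z"
    using S smooth_on_continuous_on[OF smooth_on_dir[OF smooth_on_dir[OF S(2)]]] continuous_on_eq_continuous_at by blast
  then obtain r1 where r1: "r1 > 0" "\<And>z'. dist z' z < r1 \<Longrightarrow> dist (?g z') (?g z) < \<epsilon>"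
    using \<open>0 < \<epsilon>\<close> unfolding continuous_at_eps_delta by blast
  obtain r2 where r2: "r2 > 0" "ball z r2 \<subseteq> S" using S open_contains_ball by blast
  define r where "r = min r1 r2"
  have r: "r > 0" "\<And>z'. dist z z' < r \<Longrightarrow> z' \<in> S" "\<And>z'. dist z z' < r \<Longrightarrow> norm (?g z' - ?g z) \<le> \<epsilon>"
    using r1 r2 unfolding r_def by (auto simp: dist_commute dist_norm less_imp_le subset_iff)
  \<comment> \<open>With this \<open>d\<close> the whole parallelogram spanned by
    \<open>h *\<^sub>R v\<close> and \<open>h *\<^sub>R u\<close> lies within distance
    \<open>r\<close> of \<open>z\<close>; the summand 1 keeps the denominator positive when
    \<open>u\<close> and \<open>v\<close> vanish.\<close>
  define d where "d = r / (norm u + norm v + 1)"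
  have pos: "norm u + norm v + 1 > 0" by (smt (verit) norm_ge_zero)
  show ?thesis
  proof (intro exI[of _ d] conjI allI impI)
    show "0 < d" using r(1) pos by (simp add: d_def)
    fix h assume h: "0 < h \<and> h < d"
    have near: "dist z (z + s *\<^sub>R v + t *\<^sub>R u) < r" if "0 \<le> s" "s \<le> h" "0 \<le> t" "t \<le> h" for s t
    proof -
      have "norm (s *\<^sub>R v + t *\<^sub>R u) \<le> s * norm v + t * norm u"
        using that by (metis abs_of_nonneg norm_scaleR norm_triangle_ineq)
      also have "\<dots> \<le> h * norm v + h * norm u" using that by (intro add_mono mult_right_mono) auto
      also have "\<dots> < h * (norm u + norm v + 1)" using h by (simp add: algebra_simps)
      also have "\<dots> < r" using h pos by (simp add: d_def field_simps)
      finally show ?thesis by (simp add: dist_norm norm_minus_commute algebra_simps)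
    qed
    let ?c = "?g z"
    let ?G' = "\<lambda>t. dir f u (z + h *\<^sub>R v + t *\<^sub>R u) - dir f u (z + t *\<^sub>R u) - h *\<^sub>R ?c"
    let ?G = "\<lambda>t. f (z + h *\<^sub>R v + t *\<^sub>R u) - f (z + t *\<^sub>R u) - t *\<^sub>R h *\<^sub>R ?c"
    have inner: "norm (?G' t) \<le> \<epsilon> * h" if t: "0 \<le> t" "t \<le> h" for t
    proof -
      let ?K = "\<lambda>s. dir f u ((z + t *\<^sub>R u) + s *\<^sub>R v) - s *\<^sub>R ?c"
      have "norm (?K h - ?K 0) \<le> \<epsilon> * h"
      proof (rule norm_increment_le[where e = ?K and e' = "\<lambda>s. ?g ((z + t *\<^sub>R u) + s *\<^sub>R v) - ?c"])
        fix s assume s: "0 \<le> s" "s \<le> h"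
        note n = near[OF s t]
        have eq: "z + t *\<^sub>R u + s *\<^sub>R v = z + s *\<^sub>R v + t *\<^sub>R u" by simp
        show "norm (?g ((z + t *\<^sub>R u) + s *\<^sub>R v) - ?c) \<le> \<epsilon>" unfolding eq using r(3)[OF n] .
        have "z + t *\<^sub>R u + s *\<^sub>R v \<in> S" unfolding eq using r(2)[OF n] .
        note L = has_derivative_along_line[OF smooth_on_dir[OF S(2), of u] this]
        have "((\<lambda>s. s *\<^sub>R ?c) has_derivative (\<lambda>k. k *\<^sub>R ?c)) (at s)"
          by (auto intro!: derivative_eq_intros)
        from has_derivative_diff[OF L this]
        show "(?K has_derivative (\<lambda>k. k *\<^sub>R (?g ((z + t *\<^sub>R u) + s *\<^sub>R v) - ?c))) (at s)"
          by (simp only: scaleR_diff_right)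
      qed (use h in auto)
      moreover have eq: "?K h - ?K 0 = ?G' t" by (simp add: algebra_simps)
      ultimately show ?thesis unfolding eq by blast
    qed
    have "norm (?G h - ?G 0) \<le> \<epsilon> * h * h"
    proof (rule norm_increment_le[where e = ?G and e' = ?G'])
      fix t assume t: "0 \<le> t" "t \<le> h"
      have "z + h *\<^sub>R v + t *\<^sub>R u \<in> S" "z + t *\<^sub>R u \<in> S"
        using r(2)[OF near[of h t]] r(2)[OF near[of 0 t]] t h by auto
      note L = this[THEN has_derivative_along_line[OF S(2)]]
      have "((\<lambda>t. t *\<^sub>R h *\<^sub>R ?c) has_derivative (\<lambda>k. k *\<^sub>R h *\<^sub>R ?c)) (at t)"
        by (auto intro!: derivative_eq_intros)
      from has_derivative_diff[OF has_derivative_diff[OF L] this]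
      show "(?G has_derivative (\<lambda>k. k *\<^sub>R ?G' t)) (at t)"
        by (simp only: scaleR_diff_right)
    qed (use inner h in auto)
    moreover have "?G h - ?G 0 = f (z + h *\<^sub>R v + h *\<^sub>R u) - f (z + h *\<^sub>R u) - f (z + h *\<^sub>R v) + f z - (h * h) *\<^sub>R ?c"
      by simp
    ultimately show "norm (f (z + h *\<^sub>R v + h *\<^sub>R u) - f (z + h *\<^sub>R u) - f (z + h *\<^sub>R v) + f z - (h * h) *\<^sub>R ?c)
        \<le> \<epsilon> * (h * h)"
      by (metis mult.assoc)
  qed
qed

text \<open>The second difference is unchanged when \<open>u\<close> and \<open>v\<close> are
  exchanged, and divided by \<open>h * h\<close> it is close to either mixed derivative.\<close>

lemma dir_commute:
  fixes f :: "'a::euclidean_space \<Rightarrow> 'b::real_normed_vector"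
  assumes S: "open S" "smooth_on S f" "z \<in> S"
  shows "dir (dir f u) v z = dir (dir f v) u z"
proof -
  let ?a = "dir (dir f u) v z" and ?b = "dir (dir f v) u z"
  have "norm (?a - ?b) \<le> \<epsilon>" if "0 < \<epsilon>" for \<epsilon>
  proof -
    let ?D = "\<lambda>h. f (z + h *\<^sub>R v + h *\<^sub>R u) - f (z + h *\<^sub>R u) - f (z + h *\<^sub>R v) + f z"
    have "\<epsilon> / 2 > 0" using that by simp
    from second_difference[OF S this, of v u] second_difference[OF S this, of u v]
    obtain d1 d2 where d: "d1 > 0" "d2 > 0"
      "\<And>h. 0 < h \<Longrightarrow> h < d1 \<Longrightarrow> norm (?D h - (h * h) *\<^sub>R ?a) \<le> \<epsilon> / 2 * (h * h)"
      "\<And>h. 0 < h \<Longrightarrow> h < d2 \<Longrightarrow> norm (f (z + h *\<^sub>R u + h *\<^sub>R v) - f (z + h *\<^sub>R v) - f (z + h *\<^sub>R u) + f z - (h * h) *\<^sub>R ?b) \<le> \<epsilon> / 2 * (h * h)"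
      by blast
    define h where "h = min d1 d2 / 2"
    have h: "0 < h" "h < d1" "h < d2" using d(1,2) by (auto simp: h_def)
    have "norm (?D h - (h * h) *\<^sub>R ?b) \<le> \<epsilon> / 2 * (h * h)"
      using d(4)[OF h(1,3)] by (simp add: algebra_simps)
    with d(3)[OF h(1,2)] have "norm ((h * h) *\<^sub>R ?b - (h * h) *\<^sub>R ?a) \<le> \<epsilon> * (h * h)"
      using norm_triangle_ineq4[of "?D h - (h * h) *\<^sub>R ?a" "?D h - (h * h) *\<^sub>R ?b"] by simp
    then have "(h * h) * norm (?b - ?a) \<le> (h * h) * \<epsilon>"
      using h(1) by (simp flip: scaleR_diff_right add: mult.commute)
    then show ?thesis using h(1) by (simp add: norm_minus_commute)
  qed
  then have "norm (?a - ?b) \<le> 0" by (rule field_le_epsilon[of _ 0, simplified])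
  then show ?thesis by simp
qed

section \<open>Differentiation of families of linear maps\<close>

lemma has_derivative_linear_family:
  fixes F :: "'x::real_normed_vector \<Rightarrow> 'a::euclidean_space \<Rightarrow> 'b::real_normed_vector"
  assumes "open N" "x0 \<in> N" and lin: "\<And>x. x \<in> N \<Longrightarrow> linear (F x)"
    and F': "\<And>e. ((\<lambda>x. F x e) has_derivative F' e) (at x0)"
    and Y': "(Y has_derivative Y') (at x0)"
  shows "((\<lambda>x. F x (Y x)) has_derivative (\<lambda>v. F' (Y x0) v + F x0 (Y' v))) (at x0)"
proof -
  \<comment> \<open>Differentiability is known only for each fixed vector, so the moving argument is
    expanded in the basis. The derivative comes out with a basis sum in place of
    \<open>F' (Y x0)\<close>.\<close>
  have exp: "((\<lambda>x. F x (X x)) has_derivative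
      (\<lambda>v. (\<Sum>b\<in>Basis. (X x0 \<bullet> b) *\<^sub>R F' b v) + F x0 (X' v))) (at x0)"
    if X': "(X has_derivative X') (at x0)" for X X'
  proof -
    have "((\<lambda>x. \<Sum>b\<in>Basis. (X x \<bullet> b) *\<^sub>R F x b) has_derivative
        (\<lambda>v. \<Sum>b\<in>Basis. (X x0 \<bullet> b) *\<^sub>R F' b v + (X' v \<bullet> b) *\<^sub>R F x0 b)) (at x0)"
      by (intro has_derivative_sum has_derivative_scaleR has_derivative_inner_left X' F')
    also have "(\<lambda>v. \<Sum>b\<in>Basis. (X x0 \<bullet> b) *\<^sub>R F' b v + (X' v \<bullet> b) *\<^sub>R F x0 b) =
        (\<lambda>v. (\<Sum>b\<in>Basis. (X x0 \<bullet> b) *\<^sub>R F' b v) + F x0 (X' v))"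
      by (simp add: sum.distrib linear_basis_expansion[OF lin[OF \<open>x0 \<in> N\<close>], of "X' _"])
    finally show ?thesis
      by (rule has_derivative_transform_within_open[OF _ \<open>open N\<close> \<open>x0 \<in> N\<close>])
        (rule linear_basis_expansion[OF lin, symmetric])
  qed
  \<comment> \<open>Linearity of \<open>F'\<close> in its first argument is not assumed. Applying
    \<open>exp\<close> to the constant argument \<open>Y x0\<close> and comparing derivatives yields
    the missing expansion.\<close>
  have "F' (Y x0) = (\<lambda>v. (\<Sum>b\<in>Basis. (Y x0 \<bullet> b) *\<^sub>R F' b v) + F x0 0)"
    by (rule has_derivative_unique[OF F' exp]) (rule has_derivative_const)
  then have "F' (Y x0) = (\<lambda>v. \<Sum>b\<in>Basis. (Y x0 \<bullet> b) *\<^sub>R F' b v)"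
    using linear_0[OF lin[OF \<open>x0 \<in> N\<close>]] by simp
  with exp[OF Y'] show ?thesis by simp
qed

text \<open>The sum of \<open>norm (b - G b)\<close> over the basis bounds the operator norm of
  \<open>I - G\<close>. Being at most 1/2, it forces a lower bound on \<open>G\<close>, hence
  injectivity and, the dimension being finite, bijectivity.\<close>

lemma linear_near_id:
  fixes G :: "'a::euclidean_space \<Rightarrow> 'a"
  assumes "linear G" and "(\<Sum>b\<in>Basis. norm (b - G b)) \<le> 1 / 2"
  shows "bij G" and "norm (u - G u) \<le> (\<Sum>b\<in>Basis. norm (b - G b)) * norm u"
    and "norm u \<le> 2 * norm (G u)"
proof -
  have d: "norm (u - G u) \<le> (\<Sum>b\<in>Basis. norm (b - G b)) * norm u" for u
  proof -
    have "linear (\<lambda>u. u - G u)" by (intro linear_compose_sub assms(1) linear_id[unfolded id_def])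
    then have "u - G u = (\<Sum>b\<in>Basis. (u \<bullet> b) *\<^sub>R (b - G b))" by (rule linear_basis_expansion)
    then show ?thesis using norm_basis_sum_le[of "\<lambda>b. b - G b" "\<lambda>b. norm (b - G b)" u] by simp
  qed
  then show "norm (u - G u) \<le> (\<Sum>b\<in>Basis. norm (b - G b)) * norm u" .
  have n: "norm u \<le> 2 * norm (G u)" for u
  proof -
    have "norm (u - G u) \<le> 1 / 2 * norm u"
      using d[of u] mult_right_mono[OF assms(2) norm_ge_zero[of u]] by linarith
    then show ?thesis using norm_triangle_ineq2[of u "G u"] by linarith
  qed
  then show "norm u \<le> 2 * norm (G u)" .
  have "u = 0" if "G u = 0" for u using n[of u] that by simp
  then have "inj G" using linear_injective_0[OF assms(1)] by blast
  then show "bij G" using assms(1) linear_injective_imp_surjective by (auto simp: bij_def)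
qed

text \<open>Serves the inverse parallelism in the compatibility tensor. The formula is what
  differentiating \<open>G x (inv (G x) (k x)) = k x\<close> suggests where \<open>G\<close> is the
  identity, but differentiability of the inverse has to be established as well.\<close>

lemma has_derivative_inverse_family:
  fixes G :: "'a::euclidean_space \<Rightarrow> 'b::euclidean_space \<Rightarrow> 'b"
  assumes N: "open N" "x0 \<in> N" and lin: "\<And>x. x \<in> N \<Longrightarrow> linear (G x)"
    and id: "G x0 = id"
    and G': "\<And>e. ((\<lambda>x. G x e) has_derivative G' e) (at x0)"
    and k': "(k has_derivative k') (at x0)"
  shows "\<exists>N'. open N' \<and> x0 \<in> N' \<and> N' \<subseteq> N \<and> (\<forall>x\<in>N'. bij (G x))"
    and "((\<lambda>x. inv (G x) (k x)) has_derivative (\<lambda>v. k' v - G' (k x0) v)) (at x0)"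
proof -
  define \<epsilon> where "\<epsilon> x = (\<Sum>b\<in>Basis. norm (b - G x b))" for x
  have \<epsilon>0: "(\<epsilon> \<longlongrightarrow> 0) (at x0)"
  proof -
    have "((\<lambda>x. norm (b - G x b)) \<longlongrightarrow> norm (b - G x0 b)) (at x0)" for b
      using has_derivative_continuous[OF G'[of b]] unfolding continuous_at
      by (intro tendsto_intros)
    then show ?thesis unfolding \<epsilon>_def using id by (intro tendsto_null_sum) simp
  qed
  have "\<forall>\<^sub>F x in at x0. \<epsilon> x < 1 / 2 \<and> x \<in> N"
    using order_tendstoD(2)[OF \<epsilon>0, of "1/2"] eventually_at_in_open'[OF N] by (auto simp: eventually_conj)
  then obtain N0 where N0: "open N0" "x0 \<in> N0" "\<And>x. x \<in> N0 \<Longrightarrow> x \<noteq> x0 \<Longrightarrow> \<epsilon> x < 1 / 2 \<and> x \<in> N"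
    unfolding eventually_at_topological by blast
  have \<epsilon>: "\<epsilon> x \<le> 1 / 2" "x \<in> N" if "x \<in> N0" for x
    using N0(3)[OF that] id N by (cases "x = x0"; force simp: \<epsilon>_def)+
  note near = linear_near_id[OF lin[OF \<epsilon>(2)] \<epsilon>(1)[unfolded \<epsilon>_def], folded \<epsilon>_def]
  show "\<exists>N'. open N' \<and> x0 \<in> N' \<and> N' \<subseteq> N \<and> (\<forall>x\<in>N'. bij (G x))"
    using N0 \<epsilon> near(1) by (intro exI[of _ N0]) auto
  define W where "W = k x0"
  define u where "u x = k x - G x W" for x
  \<comment> \<open>\<open>W + u x\<close> is the first order guess for the preimage of
    \<open>k x\<close>. Applying \<open>G x\<close> to the error \<open>R x\<close> gives
    \<open>u x - G x (u x)\<close>, so the error is at most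
    \<open>2 * \<epsilon> x * norm (u x)\<close>: a factor tending to 0 times one of first
    order.\<close>
  define R where "R x = inv (G x) (k x) - W - u x" for x
  have u': "(u has_derivative (\<lambda>v. k' v - G' W v)) (at x0)"
    unfolding u_def by (intro has_derivative_diff k' G')
  have u0: "u x0 = 0" using id by (simp add: u_def W_def)
  have Rb: "norm (R x) \<le> 2 * \<epsilon> x * norm (u x)" if x: "x \<in> N0" for x
  proof -
    let ?g = "inv (G x)"
    have G: "G x (?g y) = y" for y using near(1)[OF x x] by (simp add: bij_is_surj surj_f_inv_f)
    have l: "linear (G x)" using lin \<epsilon>(2)[OF x] .
    have "G x (R x) = u x - G x (u x)"
      by (simp add: R_def linear_diff[OF l] G u_def)
    then have "norm (R x) \<le> 2 * norm (u x - G x (u x))" using near(3)[OF x x, of "R x" ] by simp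
    with near(2)[OF x x, of "u x"] show ?thesis by simp
  qed
  have R': "(R has_derivative (\<lambda>v. 0)) (at x0)"
    unfolding has_derivative_at_within
  proof (intro conjI bounded_linear_zero)
    have R0: "R x0 = 0" using Rb[OF N0(2)] u0 by simp
    obtain B where B: "\<And>x. norm (k' x - G' W x) \<le> B * norm x"
      using bounded_linear.bounded[OF has_derivative_bounded_linear[OF u']] by (metis mult.commute)
    have lim: "((\<lambda>y. (1 / norm (y - x0)) *\<^sub>R (u y - u x0 - (k' (y - x0) - G' W (y - x0)))) \<longlongrightarrow> 0) (at x0)"
      using u' unfolding has_derivative_at_within by (simp add: inverse_eq_divide)
    have lim': "((\<lambda>y. 2 * \<epsilon> y * (norm ((1 / norm (y - x0)) *\<^sub>R (u y - u x0 - (k' (y - x0) - G' W (y - x0)))) + \<bar>B\<bar>)) \<longlongrightarrow> 2 * 0 * (norm (0::'b) + \<bar>B\<bar>)) (at x0)"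
      by (intro tendsto_intros \<epsilon>0 lim)
    have "\<forall>\<^sub>F y in at x0. norm ((1 / norm (y - x0)) *\<^sub>R (R y - R x0 - 0)) \<le>
      2 * \<epsilon> y * (norm ((1 / norm (y - x0)) *\<^sub>R (u y - u x0 - (k' (y - x0) - G' W (y - x0)))) + \<bar>B\<bar>)"
      unfolding eventually_at_topological
    proof (intro exI[of _ N0] conjI ballI impI N0)
      fix y assume y: "y \<in> N0" "y \<noteq> x0"
      let ?n = "norm (y - x0)" and ?l = "k' (y - x0) - G' W (y - x0)"
      have n: "?n > 0" using y by simp
      have "norm (u y) \<le> norm (u y - ?l) + \<bar>B\<bar> * ?n"
        using norm_triangle_sub[of "u y" ?l] B[of "y - x0"] abs_ge_self[of B] mult_right_mono[OF abs_ge_self[of B] norm_ge_zero[of "y - x0"]]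
        by linarith
      then have "norm (u y) / ?n \<le> norm (u y - ?l) / ?n + \<bar>B\<bar>" using n by (simp add: field_simps)
      moreover have "norm (R y) / ?n \<le> 2 * \<epsilon> y * (norm (u y) / ?n)"
        using divide_right_mono[OF Rb[OF y(1)], of ?n] n by simp
      moreover have "0 \<le> 2 * \<epsilon> y" by (auto simp: \<epsilon>_def intro: sum_nonneg)
      ultimately have "norm (R y) / ?n \<le> 2 * \<epsilon> y * (norm (u y - ?l) / ?n + \<bar>B\<bar>)"
        by (meson mult_left_mono order_trans)
      then show "norm ((1 / ?n) *\<^sub>R (R y - R x0 - 0)) \<le> 2 * \<epsilon> y * (norm ((1 / ?n) *\<^sub>R (u y - u x0 - ?l)) + \<bar>B\<bar>)"
        using n R0 u0 by simp
    qed
    from Lim_null_comparison[OF this lim'[unfolded mult_zero_right mult_zero_left]]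
    show "((\<lambda>y. (R y - R x0 - 0) /\<^sub>R norm (y - x0)) \<longlongrightarrow> 0) (at x0)"
      by (simp add: inverse_eq_divide)
  qed
  have "((\<lambda>x. W + u x + R x) has_derivative (\<lambda>v. 0 + (k' v - G' W v) + 0)) (at x0)"
    by (intro has_derivative_add has_derivative_const u' R')
  then show "((\<lambda>x. inv (G x) (k x)) has_derivative (\<lambda>v. k' v - G' (k x0) v)) (at x0)"
    by (simp add: R_def W_def)
qed

section \<open>Partial derivatives on a product and at the diagonal\<close>

lemma has_derivative_slice1:
  "(g has_derivative g') (at (x, x')) \<Longrightarrow> ((\<lambda>x. g (x, x')) has_derivative (\<lambda>v. g' (v, 0))) (at x)"
  by (rule has_derivative_compose[of "\<lambda>x. (x, x')" "\<lambda>v. (v, 0)"])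
    (auto intro!: has_derivative_Pair derivative_eq_intros)

lemma has_derivative_slice2:
  "(g has_derivative g') (at (x, x')) \<Longrightarrow> ((\<lambda>x'. g (x, x')) has_derivative (\<lambda>v. g' (0, v))) (at x')"
  by (rule has_derivative_compose[of "\<lambda>x'. (x, x')" "\<lambda>v. (0, v)"])
    (auto intro!: has_derivative_Pair derivative_eq_intros)

text \<open>The diagonal map has derivative \<open>(v, v)\<close> in direction \<open>v\<close>, and
  a function constant along the diagonal has vanishing derivative there. Applied below to the
  parallelism and to the derivative of the logarithm in its second argument.\<close>

lemma dir_constant_on_diagonal:
  fixes g :: "'a::euclidean_space \<times> 'a \<Rightarrow> 'b::real_normed_vector"
  assumes "smooth_on \<Omega> g" "open R" "x \<in> R" "(x, x) \<in> \<Omega>" "\<And>x. x \<in> R \<Longrightarrow> g (x, x) = c"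
  shows "dir g (v, 0) (x, x) = - dir g (0, v) (x, x)"
proof -
  note g' = smooth_on_has_derivative[OF assms(1,4)]
  have 1: "((\<lambda>x. g (x, x)) has_derivative (\<lambda>v. dir g (v, v) (x, x))) (at x)"
    by (rule has_derivative_compose[of "\<lambda>x. (x, x)" "\<lambda>v. (v, v)", OF _ g'])
      (auto intro!: has_derivative_Pair derivative_eq_intros)
  have 2: "((\<lambda>x. g (x, x)) has_derivative (\<lambda>v. 0)) (at x)"
    by (rule has_derivative_transform_within_open[OF _ assms(2,3), of "\<lambda>_. c"]) (auto simp: assms(5))
  have "dir g (v, v) (x, x) = 0"
    by (rule fun_cong[OF has_derivative_unique[OF 1 2]])
  moreover have "dir g ((v, 0) + (0, v)) (x, x) = dir g (v, 0) (x, x) + dir g (0, v) (x, x)"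
    by (rule linear_add[OF smooth_on_linear_dir[OF assms(1,4)]])
  ultimately show ?thesis by (simp add: eq_neg_iff_add_eq_0)
qed

section \<open>Tangent vectors in a chart\<close>

text \<open>The locale is also interpreted at reference charts \<open>tchart A m\<close> and at
  arbitrary \<open>\<eta> \<in> A\<close>, which gives both directions of a transition map from one
  set of lemmas.\<close>

locale smooth_chart =
  fixes A :: "('m::{t2_space,second_countable_topology}, 'e::euclidean_space) chart set"
    and \<phi> :: "('m, 'e) chart"
  assumes smooth_structure: "smooth_structure A" and chart_in: "\<phi> \<in> A"
begin

abbreviation R where "R \<equiv> cfun \<phi> ` cdom \<phi>"

abbreviation dc where "dc \<equiv> tderiv A (cfun \<phi>)"

abbreviation ic where "ic m \<equiv> inv (tderiv A (cfun \<phi>) m)"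

lemma is_chart: "is_chart \<phi>"
  using smooth_structure chart_in unfolding smooth_structure_def by blast

lemma transition_smooth_on:
  "\<eta> \<in> A \<Longrightarrow> smooth_on (cfun \<phi> ` (cdom \<phi> \<inter> cdom \<eta>)) (cfun \<eta> \<circ> cinv \<phi>)"
  "\<eta> \<in> A \<Longrightarrow> smooth_on (cfun \<eta> ` (cdom \<eta> \<inter> cdom \<phi>)) (cfun \<phi> \<circ> cinv \<eta>)"
  using smooth_structure chart_in unfolding smooth_structure_def smooth_compatible_def by blast+

lemma open_cdom: "open (cdom \<phi>)" and open_R: "open R"
  using is_chart by (simp_all add: is_chart_def)

lemma cinv_cfun: "m \<in> cdom \<phi> \<Longrightarrow> cinv \<phi> (cfun \<phi> m) = m"
  and cfun_cinv: "x \<in> R \<Longrightarrow> cfun \<phi> (cinv \<phi> x) = x"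
  and cinv_in: "x \<in> R \<Longrightarrow> cinv \<phi> x \<in> cdom \<phi>"
  and continuous_on_cfun: "continuous_on (cdom \<phi>) (cfun \<phi>)"
  and continuous_on_cinv: "continuous_on R (cinv \<phi>)"
  using is_chart unfolding is_chart_def homeomorphism_def by auto

lemma cfun_image_eq: "cfun \<phi> ` (cdom \<phi> \<inter> N) = R \<inter> cinv \<phi> -` N"
  using cinv_cfun cinv_in cfun_cinv by (force simp: image_iff)

lemma open_cfun_image: "open N \<Longrightarrow> open (cfun \<phi> ` (cdom \<phi> \<inter> N))"
  unfolding cfun_image_eq by (rule continuous_open_preimage[OF continuous_on_cinv open_R])

lemma open_chart_image2:
  assumes "open \<D>"
  shows "open (chart_image2 \<D> \<phi> \<phi>)"
proof -
  have "chart_image2 \<D> \<phi> \<phi> = (R \<times> R) \<inter> (\<lambda>z. (cinv \<phi> (fst z), cinv \<phi> (snd z))) -` \<D>"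
    using cinv_cfun cfun_cinv cinv_in by (fastforce simp: chart_image2_def)
  moreover have "continuous_on (R \<times> R) (\<lambda>z. (cinv \<phi> (fst z), cinv \<phi> (snd z)))"
    by (intro continuous_on_Pair continuous_on_compose2[OF continuous_on_cinv] continuous_intros) auto
  ultimately show ?thesis
    using continuous_open_preimage[OF _ open_Times[OF open_R open_R] assms] by simp
qed

lemma tchart: "tchart A m \<in> A" "m \<in> cdom (tchart A m)"
proof -
  have "\<exists>\<theta>. \<theta> \<in> A \<and> m \<in> cdom \<theta>" using smooth_structure unfolding smooth_structure_def by blast
  from someI_ex[OF this] show "tchart A m \<in> A" "m \<in> cdom (tchart A m)"
    unfolding tchart_def by blast+
qed

lemma transition_has_derivative:
  assumes "\<eta> \<in> A" "m \<in> cdom \<phi>" "m \<in> cdom \<eta>"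
  shows "((cfun \<phi> \<circ> cinv \<eta>) has_derivative frechet_derivative (cfun \<phi> \<circ> cinv \<eta>) (at (cfun \<eta> m))) (at (cfun \<eta> m))"
  by (rule smooth_on_has_derivative[OF transition_smooth_on(2)]) (use assms in auto)

lemma dc_has_derivative:
  "m \<in> cdom \<phi> \<Longrightarrow> ((cfun \<phi> \<circ> cinv (tchart A m)) has_derivative dc m) (at (cfun (tchart A m) m))"
  unfolding tderiv_def using transition_has_derivative tchart by blast

text \<open>The chain rule through the transition from the reference chart to \<open>\<phi>\<close>.
  The arbitrary choice of reference chart survives only in \<open>dc m v\<close>, so later
  computations can take place in \<open>\<phi>\<close>.\<close>

lemma tderiv_eq:
  assumes m: "m \<in> cdom \<phi>" and f': "((f \<circ> cinv \<phi>) has_derivative f') (at (cfun \<phi> m))"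
  shows "tderiv A f m v = f' (dc m v)"
proof -
  define \<theta> where "\<theta> = tchart A m"
  interpret \<theta>: smooth_chart A \<theta>
    using tchart smooth_structure by unfold_locales (auto simp: \<theta>_def)
  have m\<theta>: "m \<in> cdom \<theta>" using tchart(2) by (simp add: \<theta>_def)
  note d = dc_has_derivative[OF m, folded \<theta>_def]
  have "((\<lambda>x. (f \<circ> cinv \<phi>) ((cfun \<phi> \<circ> cinv \<theta>) x)) has_derivative (\<lambda>v. f' (dc m v))) (at (cfun \<theta> m))"
    by (rule has_derivative_compose[OF d]) (use f' in \<open>simp add: o_def \<theta>.cinv_cfun[OF m\<theta>]\<close>)
  then have "((f \<circ> cinv \<theta>) has_derivative (\<lambda>v. f' (dc m v))) (at (cfun \<theta> m))"
    by (rule has_derivative_transform_within_open[OF _ \<theta>.open_cfun_image[OF open_cdom]])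
      (use m m\<theta> \<theta>.cinv_cfun cinv_cfun in auto)
  from frechet_derivative_at[OF this] show ?thesis
    by (simp add: tderiv_def \<theta>_def fun_eq_iff)
qed

lemma linear_dc: "m \<in> cdom \<phi> \<Longrightarrow> linear (dc m)"
  using dc_has_derivative has_derivative_linear by blast

text \<open>The two transition maps are mutually inverse near the point, so \<open>dc m\<close> has
  a left inverse; equal finite dimensions do the rest.\<close>

lemma bij_dc:
  assumes m: "m \<in> cdom \<phi>"
  shows "bij (dc m)"
proof -
  define \<theta> where "\<theta> = tchart A m"
  interpret \<theta>: smooth_chart A \<theta>
    using tchart smooth_structure by unfold_locales (auto simp: \<theta>_def)
  have m\<theta>: "m \<in> cdom \<theta>" using tchart(2) by (simp add: \<theta>_def)
  note d = dc_has_derivative[OF m, folded \<theta>_def]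
  obtain g' where g': "((cfun \<theta> \<circ> cinv \<phi>) has_derivative g') (at (cfun \<phi> m))"
    using \<theta>.transition_has_derivative[OF chart_in m\<theta> m] by blast
  have "((\<lambda>x. (cfun \<theta> \<circ> cinv \<phi>) ((cfun \<phi> \<circ> cinv \<theta>) x)) has_derivative (\<lambda>v. g' (dc m v))) (at (cfun \<theta> m))"
    by (rule has_derivative_compose[OF d]) (use g' in \<open>simp add: o_def \<theta>.cinv_cfun[OF m\<theta>]\<close>)
  then have "((\<lambda>x. x) has_derivative (\<lambda>v. g' (dc m v))) (at (cfun \<theta> m))"
    by (rule has_derivative_transform_within_open[OF _ \<theta>.open_cfun_image[OF open_cdom]])
      (use m m\<theta> \<theta>.cinv_cfun cinv_cfun in auto)
  from has_derivative_unique[OF this has_derivative_ident]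
  have "inj (dc m)" by (metis injI)
  then show ?thesis using linear_injective_imp_surjective[OF linear_dc[OF m]] by (simp add: bij_def)
qed

lemma ic_dc: "m \<in> cdom \<phi> \<Longrightarrow> ic m (dc m v) = v"
  and dc_ic: "m \<in> cdom \<phi> \<Longrightarrow> dc m (ic m e) = e"
  using bij_dc by (simp_all add: bij_is_inj bij_is_surj surj_f_inv_f)

lemma linear_ic: "m \<in> cdom \<phi> \<Longrightarrow> linear (ic m)"
  using linear_dc bij_dc by (simp add: bij_is_inj inj_linear_imp_inv_linear)

definition const_field where "const_field e m = ic m e"

text \<open>In a chart \<open>\<eta>\<close> the components are the derivative of the transition map
  in the fixed direction \<open>e\<close>. Such fields pass through every tangent vector over the
  chart, which is what makes the description in \<open>nabla_form\<close> determine a value.\<close>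

lemma smooth_const_field: "smooth_vector_field_on A (cdom \<phi>) (const_field e)"
  unfolding smooth_vector_field_on_def
proof
  fix \<eta> assume "\<eta> \<in> A"
  interpret \<eta>: smooth_chart A \<eta> by unfold_locales (fact smooth_structure \<open>\<eta> \<in> A\<close>)+
  let ?N = "cfun \<eta> ` (cdom \<eta> \<inter> cdom \<phi>)"
  let ?\<tau> = "cfun \<eta> \<circ> cinv \<phi>"
  note s = transition_smooth_on[OF \<open>\<eta> \<in> A\<close>]
  show "smooth_on ?N (\<lambda>x. tderiv A (cfun \<eta>) (cinv \<eta> x) (const_field e (cinv \<eta> x)))"
  proof (rule smooth_on_cong[OF \<eta>.open_cfun_image[OF open_cdom]])
    show "smooth_on ?N (dir ?\<tau> e \<circ> (cfun \<phi> \<circ> cinv \<eta>))"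
      by (rule smooth_on_compose[OF \<eta>.open_cfun_image[OF open_cdom] smooth_on_dir[OF s(1)] s(2)])
        (auto simp: \<eta>.cinv_cfun)
    fix x assume "x \<in> ?N"
    then have m: "cinv \<eta> x \<in> cdom \<phi>" "cinv \<eta> x \<in> cdom \<eta>" by (auto simp: \<eta>.cinv_cfun)
    have "((cfun \<eta> \<circ> cinv \<phi>) has_derivative frechet_derivative ?\<tau> (at (cfun \<phi> (cinv \<eta> x)))) (at (cfun \<phi> (cinv \<eta> x)))"
      by (rule \<eta>.transition_has_derivative[OF chart_in m(2,1)])
    from tderiv_eq[OF m(1) this]
    show "(dir ?\<tau> e \<circ> (cfun \<phi> \<circ> cinv \<eta>)) x = tderiv A (cfun \<eta>) (cinv \<eta> x) (const_field e (cinv \<eta> x))"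
      by (simp add: const_field_def dc_ic[OF m(1)])
  qed
qed

lemma has_derivative_ic:
  "m \<in> cdom \<phi> \<Longrightarrow> (f has_derivative f') F \<Longrightarrow> ((\<lambda>x. ic m (f x)) has_derivative (\<lambda>v. ic m (f' v))) F"
  using bounded_linear.has_derivative[OF linear_ic[unfolded linear_conv_bounded_linear]] .

text \<open>The vector precedes the point so that \<open>dir (coform \<alpha> e)\<close>
  differentiates with the coordinates of the vector frozen.\<close>

definition coform :: "('m \<Rightarrow> 'e \<Rightarrow>\<^sub>L 'v::real_normed_vector) \<Rightarrow> 'e \<Rightarrow> 'e \<Rightarrow> 'v" where
  "coform \<alpha> e x = \<alpha> (cinv \<phi> x) (ic (cinv \<phi> x) e)"

lemma smooth_on_coform: "smooth_one_form A \<alpha> \<Longrightarrow> smooth_on R (coform \<alpha> e)"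
  using chart_in unfolding smooth_one_form_def coform_def[abs_def] by blast

lemma linear_coform: "x \<in> R \<Longrightarrow> linear (\<lambda>e. coform \<alpha> e x)"
  unfolding coform_def
  by (intro linear_compose[OF linear_ic[OF cinv_in], unfolded o_def] bounded_linear.linear[OF blinfun.bounded_linear_right])

lemma coform_cfun: "m \<in> cdom \<phi> \<Longrightarrow> coform \<alpha> e (cfun \<phi> m) = \<alpha> m (ic m e)"
  by (simp add: coform_def cinv_cfun)

lemma tderiv_coform:
  assumes "smooth_one_form A \<alpha>" "m \<in> cdom \<phi>"
  shows "tderiv A (\<lambda>n. \<alpha> n (ic n e)) m v = dir (coform \<alpha> e) (dc m v) (cfun \<phi> m)"
proof (rule tderiv_eq[OF assms(2)])
  have "(\<lambda>n. \<alpha> n (ic n e)) \<circ> cinv \<phi> = coform \<alpha> e" by (auto simp: coform_def)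
  then show "((\<lambda>n. \<alpha> n (ic n e)) \<circ> cinv \<phi> has_derivative (\<lambda>v. dir (coform \<alpha> e) v (cfun \<phi> m))) (at (cfun \<phi> m))"
    using smooth_on_has_derivative[OF smooth_on_coform[OF assms(1)]] assms(2) by simp
qed

lemma has_derivative_vector_field:
  assumes "smooth_vector_field_on A N Y" "m \<in> N" "m \<in> cdom \<phi>"
  shows "((\<lambda>x. dc (cinv \<phi> x) (Y (cinv \<phi> x))) has_derivative
    frechet_derivative (\<lambda>x. dc (cinv \<phi> x) (Y (cinv \<phi> x))) (at (cfun \<phi> m))) (at (cfun \<phi> m))"
  by (rule smooth_on_has_derivative[of "cfun \<phi> ` (cdom \<phi> \<inter> N)"])
    (use assms chart_in in \<open>auto simp: smooth_vector_field_on_def\<close>)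

end

section \<open>Gauges in a chart\<close>

locale chart_gauge = smooth_chart A \<phi>
  for A :: "('m::{t2_space,second_countable_topology}, 'e::euclidean_space) chart set" and \<phi> +
  fixes \<D> :: "('m \<times> 'm) set" and \<psi> :: "'m \<Rightarrow> 'm \<Rightarrow> 'e" and U :: "'m \<Rightarrow> 'm \<Rightarrow> 'e \<Rightarrow>\<^sub>L 'e"
  assumes gauge: "gauge_on A \<D> \<psi> U"
begin

abbreviation \<Omega> where "\<Omega> \<equiv> chart_image2 \<D> \<phi> \<phi>"

text \<open>Both points are read in the same chart and form one argument, so that directions
  \<open>(v, 0)\<close> and \<open>(0, v)\<close> of \<open>dir\<close> give the two partial
  derivatives; likewise for \<open>lU\<close>.\<close>

definition lpsi where
  "lpsi z = dc (cinv \<phi> (fst z)) (\<psi> (cinv \<phi> (fst z)) (cinv \<phi> (snd z)))"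

definition lU where
  "lU e z = dc (cinv \<phi> (fst z)) (U (cinv \<phi> (fst z)) (cinv \<phi> (snd z)) (ic (cinv \<phi> (snd z)) e))"

lemma open_\<Omega>: "open \<Omega>"
  using gauge open_chart_image2 by (simp add: gauge_on_def diagonal_domain_def)

lemma \<Omega>_diag: "x \<in> R \<Longrightarrow> (x, x) \<in> \<Omega>"
  using gauge unfolding gauge_on_def diagonal_domain_def chart_image2_def by blast

lemma \<Omega>_R: "(x, x') \<in> \<Omega> \<Longrightarrow> x \<in> R" "(x, x') \<in> \<Omega> \<Longrightarrow> x' \<in> R"
  by (auto simp: chart_image2_def)

lemma open_slice1: "open {x. (x, x') \<in> \<Omega>}"
  using open_vimage[OF open_\<Omega>, of "\<lambda>x. (x, x')"] by (simp add: vimage_def continuous_intros)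

lemma open_slice2: "open {x'. (x, x') \<in> \<Omega>}"
  using open_vimage[OF open_\<Omega>, of "\<lambda>x'. (x, x')"] by (simp add: vimage_def continuous_intros)

lemma smooth_lpsi: "smooth_on \<Omega> lpsi"
proof -
  have "smooth_on \<Omega> (\<lambda>(x, x'). dc (cinv \<phi> x) (\<psi> (cinv \<phi> x) (cinv \<phi> x')))"
    using gauge chart_in unfolding gauge_on_def logarithm_on_def by blast
  then show ?thesis by (simp add: lpsi_def[abs_def] case_prod_unfold)
qed

lemma smooth_lU: "smooth_on \<Omega> (lU e)"
proof -
  have "smooth_on \<Omega> (\<lambda>(x, x'). dc (cinv \<phi> x) (U (cinv \<phi> x) (cinv \<phi> x') (ic (cinv \<phi> x') e)))"
    using gauge chart_in unfolding gauge_on_def parallelism_on_def by blast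
  then show ?thesis by (simp add: lU_def[abs_def] case_prod_unfold)
qed

lemma lpsi_diag: "x \<in> R \<Longrightarrow> lpsi (x, x) = 0"
  using gauge linear_0[OF linear_dc[OF cinv_in]]
  by (simp add: lpsi_def gauge_on_def logarithm_on_def)

lemma lU_diag: "x \<in> R \<Longrightarrow> lU e (x, x) = e"
  using gauge dc_ic[OF cinv_in] by (simp add: lU_def gauge_on_def parallelism_on_def)

lemma linear_lU:
  assumes "(x, x') \<in> \<Omega>"
  shows "linear (\<lambda>e. lU e (x, x'))"
proof -
  have "linear (dc (cinv \<phi> x) \<circ> (blinfun_apply (U (cinv \<phi> x) (cinv \<phi> x')) \<circ> ic (cinv \<phi> x')))"
    using \<Omega>_R[OF assms] by (intro linear_compose linear_ic linear_dc cinv_in bounded_linear.linear[OF blinfun.bounded_linear_right])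
  then show ?thesis by (simp add: lU_def o_def)
qed

lemma psi_eq: "m \<in> cdom \<phi> \<Longrightarrow> n \<in> cdom \<phi> \<Longrightarrow> \<psi> m n = ic m (lpsi (cfun \<phi> m, cfun \<phi> n))"
  by (simp add: lpsi_def cinv_cfun ic_dc)

text \<open>The points are kept distinct because the compatibility tensor differentiates in the base
  point \<open>n\<close>, so the formula is needed near the diagonal.\<close>

lemma tderiv_psi:
  assumes n: "n \<in> cdom \<phi>" "m \<in> cdom \<phi>" and \<Omega>: "(cfun \<phi> n, cfun \<phi> m) \<in> \<Omega>"
  shows "tderiv A (\<psi> n) m w = ic n (dir lpsi (0, dc m w) (cfun \<phi> n, cfun \<phi> m))"
proof (rule tderiv_eq[OF n(2)])
  have "((\<lambda>x'. ic n (lpsi (cfun \<phi> n, x'))) has_derivative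
      (\<lambda>v. ic n (dir lpsi (0, v) (cfun \<phi> n, cfun \<phi> m)))) (at (cfun \<phi> m))"
    by (rule has_derivative_ic[OF n(1) has_derivative_slice2[OF smooth_on_has_derivative[OF smooth_lpsi \<Omega>]]])
  then show "(\<psi> n \<circ> cinv \<phi> has_derivative (\<lambda>v. ic n (dir lpsi (0, v) (cfun \<phi> n, cfun \<phi> m)))) (at (cfun \<phi> m))"
    by (rule has_derivative_transform_within_open[OF _ open_slice2])
      (use \<Omega> in \<open>auto simp: psi_eq n cinv_in cfun_cinv \<Omega>_R\<close>)
qed

lemma dir_lpsi_diag:
  assumes "x \<in> R"
  shows "dir lpsi (0, w) (x, x) = w"
proof -
  let ?m = "cinv \<phi> x"
  have m: "?m \<in> cdom \<phi>" "cfun \<phi> ?m = x" using assms by (auto simp: cinv_in cfun_cinv)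
  have "tderiv A (\<psi> ?m) ?m = id" using gauge by (simp add: gauge_on_def logarithm_on_def)
  with tderiv_psi[OF m(1,1), of "ic ?m w"] have "ic ?m (dir lpsi (0, w) (x, x)) = ic ?m w"
    using m dc_ic[OF m(1)] \<Omega>_diag[OF assms] by simp
  then show ?thesis using dc_ic[OF m(1)] by metis
qed

text \<open>The product rules for \<open>\<alpha> n (Y n)\<close> and for \<open>U m n (Y n)\<close>
  produce the same term containing the derivative of \<open>Y\<close>, because \<open>U m m\<close>
  is the identity. It cancels, and what is left depends on \<open>Y m\<close> only.\<close>

lemma nabla_form_eq:
  fixes \<alpha> :: "'m \<Rightarrow> 'e \<Rightarrow>\<^sub>L 'v::real_normed_vector"
  assumes \<alpha>: "smooth_one_form A \<alpha>" and m: "m \<in> cdom \<phi>"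
  shows "nabla_form A U \<alpha> m v w = dir (coform \<alpha> (dc m w)) (dc m v) (cfun \<phi> m)
    - \<alpha> m (ic m (dir (lU (dc m w)) (0, dc m v) (cfun \<phi> m, cfun \<phi> m)))" (is "_ = ?d")
proof -
  define x0 where "x0 = cfun \<phi> m"
  have x0: "x0 \<in> R" "cinv \<phi> x0 = m" using m by (auto simp: x0_def cinv_cfun)
  have product_rule: "tderiv A (\<lambda>n. \<alpha> n (Y n)) m v = ?d + \<alpha> m (nabla_field A U Y m v)"
    if N: "open N" "m \<in> N" and Y: "smooth_vector_field_on A N Y" and Ym: "Y m = w" for N Y
  proof -
    let ?Y = "\<lambda>x. dc (cinv \<phi> x) (Y (cinv \<phi> x))"
    note Y' = has_derivative_vector_field[OF Y N(2) m, folded x0_def]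
    have Y0: "?Y x0 = dc m w" by (simp add: x0 Ym)
    have "((\<lambda>x. coform \<alpha> (?Y x) x) has_derivative
        (\<lambda>v. dir (coform \<alpha> (?Y x0)) v x0 + coform \<alpha> (dir ?Y v x0) x0)) (at x0)"
      by (rule has_derivative_linear_family[OF open_R x0(1) linear_coform
            smooth_on_has_derivative[OF smooth_on_coform[OF \<alpha>] x0(1)] Y'])
    then have "(((\<lambda>n. \<alpha> n (Y n)) \<circ> cinv \<phi>) has_derivative
        (\<lambda>v. dir (coform \<alpha> (?Y x0)) v x0 + coform \<alpha> (dir ?Y v x0) x0)) (at (cfun \<phi> m))"
      unfolding x0_def[symmetric]
      by (rule has_derivative_transform_within_open[OF _ open_R x0(1)])
        (simp add: coform_def ic_dc cinv_in)
    from tderiv_eq[OF m this]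
    have 1: "tderiv A (\<lambda>n. \<alpha> n (Y n)) m v =
        dir (coform \<alpha> (dc m w)) (dc m v) x0 + \<alpha> m (ic m (dir ?Y (dc m v) x0))"
      by (simp add: Ym coform_def x0)
    have "((\<lambda>x'. lU (?Y x') (x0, x')) has_derivative
        (\<lambda>v. dir (lU (?Y x0)) (0, v) (x0, x0) + lU (dir ?Y v x0) (x0, x0))) (at x0)"
      by (rule has_derivative_linear_family[OF open_slice2 _ linear_lU
            has_derivative_slice2[OF smooth_on_has_derivative[OF smooth_lU \<Omega>_diag[OF x0(1)]]] Y'])
        (use \<Omega>_diag x0 in auto)
    then have "((\<lambda>x'. ic m (lU (?Y x') (x0, x'))) has_derivative
        (\<lambda>v. ic m (dir (lU (?Y x0)) (0, v) (x0, x0) + lU (dir ?Y v x0) (x0, x0)))) (at x0)"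
      by (rule has_derivative_ic[OF m])
    then have "(((\<lambda>n. U m n (Y n)) \<circ> cinv \<phi>) has_derivative
        (\<lambda>v. ic m (dir (lU (?Y x0)) (0, v) (x0, x0) + lU (dir ?Y v x0) (x0, x0)))) (at (cfun \<phi> m))"
      unfolding x0_def[symmetric]
      by (rule has_derivative_transform_within_open[OF _ open_R x0(1)])
        (simp add: lU_def x0 ic_dc cinv_in m)
    from tderiv_eq[OF m this]
    have 2: "nabla_field A U Y m v =
        ic m (dir (lU (dc m w)) (0, dc m v) (x0, x0)) + ic m (dir ?Y (dc m v) x0)"
      by (simp add: nabla_field_def Ym lU_diag x0 linear_add[OF linear_ic[OF m]])
    show ?thesis by (simp add: 1 2 x0_def blinfun.add_right)
  qed
  have Y: "smooth_vector_field_on A (cdom \<phi>) (const_field (dc m w))" "const_field (dc m w) m = w"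
    using smooth_const_field by (auto simp: const_field_def ic_dc m)
  show ?thesis
    unfolding nabla_form_def
  proof (rule the_equality)
    \<comment> \<open>Uniqueness: the field with constant coordinates is an admissible
      \<open>Y\<close>, and its instance alone fixes \<open>d\<close>.\<close>
    fix d
    assume "\<forall>N Y. open N \<and> m \<in> N \<and> smooth_vector_field_on A N Y \<and> Y m = w \<longrightarrow>
      tderiv A (\<lambda>n. \<alpha> n (Y n)) m v = d + \<alpha> m (nabla_field A U Y m v)"
    from this[rule_format, of "cdom \<phi>" "const_field (dc m w)"] product_rule[OF open_cdom m Y]
    show "d = ?d" using open_cdom m Y by simp
  qed (use product_rule in blast)
qed

lemma compat_tensor_eq:
  assumes m: "m \<in> cdom \<phi>"
  shows "compat_tensor A \<psi> U m v w =
    ic m (dir (dir lpsi (0, dc m w)) (dc m v, 0) (cfun \<phi> m, cfun \<phi> m)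
      - dir (lU (dc m w)) (dc m v, 0) (cfun \<phi> m, cfun \<phi> m))"
proof -
  define x0 where "x0 = cfun \<phi> m"
  have x0: "x0 \<in> R" "cinv \<phi> x0 = m" using m by (auto simp: x0_def cinv_cfun)
  \<comment> \<open>\<open>G\<close> is the parallelism from the fixed point \<open>m\<close> to the
    moving point, and \<open>k\<close> the derivative at \<open>m\<close> of the logarithm based at
    the moving point. The tensor is the derivative of \<open>inv (G x) (k x)\<close>, carried back
    to the tangent space at \<open>m\<close>.\<close>
  define G where "G x e = lU e (x, x0)" for x e
  define k where "k x = dir lpsi (0, dc m w) (x, x0)" for x
  have k0: "k x0 = dc m w" by (simp add: k_def dir_lpsi_diag x0)
  let ?N = "{x. (x, x0) \<in> \<Omega>}"
  have x0N: "x0 \<in> ?N" using \<Omega>_diag x0 by simp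
  have lin: "linear (G x)" if "x \<in> ?N" for x
    using linear_lU that unfolding G_def[abs_def] by simp
  have G0: "G x0 = id" by (auto simp: G_def lU_diag x0)
  have G': "((\<lambda>x. G x e) has_derivative (\<lambda>v. dir (lU e) (v, 0) (x0, x0))) (at x0)" for e
    unfolding G_def
    by (rule has_derivative_slice1[OF smooth_on_has_derivative[OF smooth_lU \<Omega>_diag[OF x0(1)]]])
  have k': "(k has_derivative (\<lambda>v. dir (dir lpsi (0, dc m w)) (v, 0) (x0, x0))) (at x0)"
    unfolding k_def
    by (rule has_derivative_slice1[OF smooth_on_has_derivative[OF smooth_on_dir[OF smooth_lpsi] \<Omega>_diag[OF x0(1)]]])
  note inv = has_derivative_inverse_family[OF open_slice1 x0N lin G0 G' k']
  obtain N' where N': "open N'" "x0 \<in> N'" "N' \<subseteq> ?N" "\<And>x. x \<in> N' \<Longrightarrow> bij (G x)"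
    using inv(1) by blast
  have eq: "ic m (inv (G x) (k x)) = inv (blinfun_apply (U (cinv \<phi> x) m)) (tderiv A (\<psi> (cinv \<phi> x)) m w)"
    if x: "x \<in> N'" for x
  proof -
    let ?n = "cinv \<phi> x"
    have \<Omega>: "(x, x0) \<in> \<Omega>" using N'(3) x by blast
    have n: "?n \<in> cdom \<phi>" "cfun \<phi> ?n = x" using \<Omega>_R[OF \<Omega>] by (auto simp: cinv_in cfun_cinv)
    have GU: "G x e = dc ?n (U ?n m (ic m e))" for e by (simp add: G_def lU_def x0)
    \<comment> \<open>\<open>inv\<close> of \<open>U ?n m\<close> undoes that map only if it is
      injective; this is inherited from the bijectivity of \<open>G x\<close> on
      \<open>N'\<close>.\<close>
    have "inj (blinfun_apply (U ?n m))"
    proof (rule injI)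
      fix a b assume "U ?n m a = U ?n m b"
      then have "G x (dc m a) = G x (dc m b)" by (simp add: GU ic_dc m)
      then have "dc m a = dc m b" using N'(4)[OF x] by (meson bij_is_inj injD)
      then show "a = b" using ic_dc[OF m] by metis
    qed
    moreover have "U ?n m (ic m (inv (G x) (k x))) = ic ?n (k x)"
    proof -
      have "dc ?n (U ?n m (ic m (inv (G x) (k x)))) = k x"
        using N'(4)[OF x] by (simp flip: GU add: bij_is_surj surj_f_inv_f)
      then show ?thesis using ic_dc[OF n(1)] by metis
    qed
    moreover have "tderiv A (\<psi> ?n) m w = ic ?n (k x)"
      using tderiv_psi[OF n(1) m] \<Omega> by (simp add: n k_def x0_def)
    ultimately show ?thesis by (simp add: inv_f_eq)
  qed
  have "((\<lambda>x. ic m (inv (G x) (k x))) has_derivative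
      (\<lambda>v. ic m (dir (dir lpsi (0, dc m w)) (v, 0) (x0, x0) - dir (lU (k x0)) (v, 0) (x0, x0)))) (at x0)"
    by (rule has_derivative_ic[OF m inv(2)])
  then have "(((\<lambda>n. inv (blinfun_apply (U n m)) (tderiv A (\<psi> n) m w)) \<circ> cinv \<phi>) has_derivative
      (\<lambda>v. ic m (dir (dir lpsi (0, dc m w)) (v, 0) (x0, x0) - dir (lU (k x0)) (v, 0) (x0, x0)))) (at (cfun \<phi> m))"
    unfolding x0_def[symmetric]
    by (rule has_derivative_transform_within_open[OF _ N'(1,2)]) (simp add: eq)
  from tderiv_eq[OF m this] show ?thesis
    by (simp add: compat_tensor_def k0[unfolded x0_def] x0_def)
qed

text \<open>The parallelism cancels, since its two partial derivatives are opposite on the diagonal.\<close>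

lemma nabla_form_plus_compat_tensor:
  fixes \<alpha> :: "'m \<Rightarrow> 'e \<Rightarrow>\<^sub>L 'v::real_normed_vector"
  assumes \<alpha>: "smooth_one_form A \<alpha>" and m: "m \<in> cdom \<phi>"
  shows "nabla_form A U \<alpha> m v w + \<alpha> m (compat_tensor A \<psi> U m v w) =
    tderiv A (\<lambda>n. \<alpha> n (ic n (dc m w))) m v
    - coform \<alpha> (dir (dir lpsi (0, dc m w)) (0, dc m v) (cfun \<phi> m, cfun \<phi> m)) (cfun \<phi> m)"
proof -
  have x: "cfun \<phi> m \<in> R" using m by simp
  note neg = dir_constant_on_diagonal[OF _ open_R x \<Omega>_diag[OF x]]
  have 1: "dir (dir lpsi (0, e)) (v, 0) (cfun \<phi> m, cfun \<phi> m) = - dir (dir lpsi (0, e)) (0, v) (cfun \<phi> m, cfun \<phi> m)" for e v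
    by (rule neg[OF smooth_on_dir[OF smooth_lpsi] dir_lpsi_diag])
  have 2: "dir (lU e) (v, 0) (cfun \<phi> m, cfun \<phi> m) = - dir (lU e) (0, v) (cfun \<phi> m, cfun \<phi> m)" for e v
    by (rule neg[OF smooth_lU lU_diag])
  show ?thesis
    unfolding nabla_form_eq[OF \<alpha> m] compat_tensor_eq[OF m] tderiv_coform[OF \<alpha> m] 1 2 coform_cfun[OF m]
    by (simp add: linear_diff[OF linear_ic[OF m]] linear_neg[OF linear_ic[OF m]] linear_add[OF linear_ic[OF m]]
        blinfun.diff_right blinfun.add_right blinfun.minus_right)
qed

end

section \<open>Estimates along the path\<close>

lemma tensor_eval_symmetric:
  fixes b :: "'e::real_normed_vector \<Rightarrow> 'e \<Rightarrow> 'v::real_vector"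
  assumes b: "bilinear b" "\<And>v w. b v w = b w v"
    and X: "(1 / 2) *\<^sub>R (X + transpose X) = (1 / 2) *\<^sub>R tensor2 u u"
  shows "tensor_eval b B X = (1 / 2) *\<^sub>R b (B u) (B u)"
proof -
  have 1: "tensor_eval b B (transpose X) = tensor_eval b B X"
    unfolding tensor_eval_def by (subst sum.swap) (simp add: transpose_def b(2))
  have "X + transpose X = tensor2 u u" using X by simp
  then have "tensor_eval b B (X + transpose X) = b (B u) (B u)"
    by (simp add: tensor_eval_tensor2 b(1))
  moreover have "tensor_eval b B (X + transpose X) = 2 *\<^sub>R tensor_eval b B X"
    by (simp add: tensor_eval_def scaleR_left_distrib sum.distrib scaleR_2 flip: 1[unfolded tensor_eval_def])
  ultimately show ?thesis by (metis scaleR_half_double scaleR_2 scaleR_add_right)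
qed

lemma tensor_eval_diff:
  "tensor_eval (\<lambda>v w. f v w - g v w) B X = tensor_eval f B X - tensor_eval g B X"
  by (simp add: tensor_eval_def scaleR_diff_right sum_subtractf)

text \<open>Turns the exponents of \<open>approx_on\<close> into powers of the single quantity
  \<open>\<omega> s t powr (1 / p)\<close>. At \<open>w = 0\<close> both sides vanish;
  \<open>n > 0\<close> excludes \<open>0 powr 0 = 0\<close> against
  \<open>0 ^ 0 = 1\<close>.\<close>

lemma powr_of_nat_div:
  fixes w p :: real
  assumes "n > 0"
  shows "w powr (real n / p) = (w powr (1 / p)) ^ n"
  using assms by (cases "w = 0") (auto simp: powr_power zero_power)

text \<open>Superadditivity, with the two outer pieces nonnegative. The global bound lets a higher
  power of \<open>\<omega>\<close> be absorbed into a lower one.\<close>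

lemma control_le:
  assumes "control T \<omega>" "0 \<le> s" "s \<le> t" "t \<le> T"
  shows "0 \<le> \<omega> s t" "\<omega> s t \<le> \<omega> 0 T"
proof -
  have nn: "0 \<le> \<omega> s t" if "0 \<le> s" "s \<le> t" "t \<le> T" for s t
    using assms(1) that unfolding control_def simplex_upto_def by blast
  have add: "\<omega> s t + \<omega> t u \<le> \<omega> s u" if "0 \<le> s" "s \<le> t" "t \<le> u" "u \<le> T" for s t u
    using assms(1) that unfolding control_def by blast
  show "0 \<le> \<omega> s t" using nn assms by auto
  show "\<omega> s t \<le> \<omega> 0 T"
    using add[of 0 s T] add[of s t T] nn[of 0 s] nn[of t T] assms by linarith
qed

section \<open>Second order behaviour of the logarithm near the diagonal\<close>

context chart_gauge
begin

definition lQ where "lQ x u v = dir (dir lpsi (0, v)) (0, u) (x, x)"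

lemma bilinear_lQ:
  assumes "x \<in> R"
  shows "bilinear (lQ x)"
proof -
  note b = dir_dir_bilinear[OF open_\<Omega> smooth_lpsi \<Omega>_diag[OF assms]]
  have "linear (\<lambda>v. (0, v) :: 'e \<times> 'e)" by (rule linearI) auto
  then show ?thesis
    using b unfolding bilinear_def lQ_def
    by (auto intro!: linear_compose[unfolded o_def, of "\<lambda>v. (0, v)"])
qed

lemma lQ_commute: "x \<in> R \<Longrightarrow> lQ x u v = lQ x v u"
  unfolding lQ_def by (rule dir_commute[OF open_\<Omega> smooth_lpsi \<Omega>_diag])

lemma lQ_bound:
  assumes "compact K" "K \<subseteq> R"
  shows "\<exists>C\<ge>0. \<forall>x\<in>K. \<forall>u v. norm (lQ x u v) \<le> C * norm u * norm v"
proof -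
  have "compact ((\<lambda>x. (x, x)) ` K)" "(\<lambda>x. (x, x)) ` K \<subseteq> \<Omega>"
    using assms \<Omega>_diag by (auto intro!: compact_continuous_image continuous_intros)
  from dir2_bound[OF open_\<Omega> smooth_lpsi this]
  obtain C where "C \<ge> 0" and C: "\<And>x u v. x \<in> K \<Longrightarrow> norm (dir (dir lpsi v) u (x, x)) \<le> C * norm u * norm v"
    by blast
  then show ?thesis unfolding lQ_def by (intro exI[of _ C]) (auto intro: order_trans[OF C] simp: norm_Pair)
qed

text \<open>The diagonal over \<open>K\<close> is compact inside the open set
  \<open>\<Omega>\<close>, so a closed tube of one radius \<open>r\<close> fits; the tube is compact
  and hence bounds the third derivative. The Taylor terms of order 0 and 1 are 0 and
  \<open>h\<close> by the normalisation of a logarithm.\<close>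

lemma log_expansion:
  assumes K: "compact K" "K \<subseteq> R"
  shows "\<exists>C\<ge>0. \<exists>r>0. \<forall>x\<in>K. \<forall>h. norm h \<le> r \<longrightarrow>
    norm (lpsi (x, x + h) - h - (1 / 2) *\<^sub>R lQ x h h) \<le> C * norm h ^ 3"
proof -
  let ?\<Delta> = "(\<lambda>x. (x, x)) ` K"
  have \<Delta>: "compact ?\<Delta>" "?\<Delta> \<subseteq> \<Omega>"
    using assms \<Omega>_diag by (auto intro!: compact_continuous_image continuous_intros)
  from compact_subset_open_imp_cball_epsilon_subset[OF \<Delta>(1) open_\<Omega> \<Delta>(2)]
  obtain r where r: "r > 0" "(\<Union>z\<in>?\<Delta>. cball z r) \<subseteq> \<Omega>" by blast
  from dir3_bound[OF open_\<Omega> smooth_lpsi compact_minkowski_sum_cball[OF \<Delta>(1)] r(2)]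
  obtain C where "C \<ge> 0" and C: "\<And>z u v w. z \<in> (\<Union>z\<in>?\<Delta>. cball z r) \<Longrightarrow>
      norm (dir (dir (dir lpsi w) v) u z) \<le> C * norm u * norm v * norm w"
    by blast
  show ?thesis
  proof (rule exI[of _ C], intro conjI \<open>C \<ge> 0\<close>, rule exI[of _ r], intro conjI ballI allI impI r(1))
    fix x h :: 'e assume x: "x \<in> K" and h: "norm h \<le> r"
    have seg: "(x, x) + t *\<^sub>R (0, h) \<in> (\<Union>z\<in>?\<Delta>. cball z r)" if "0 \<le> t" "t \<le> 1" for t
    proof -
      have "t * norm h \<le> r" using that h mult_left_le_one_le[of "norm h" t] by simp
      then have "dist (x, x) ((x, x) + t *\<^sub>R (0, h)) \<le> r" using that by (simp add: dist_norm norm_Pair)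
      then show ?thesis using x by auto
    qed
    have "norm (lpsi ((x, x) + (0, h)) - lpsi (x, x) - dir lpsi (0, h) (x, x)
        - (1/2) *\<^sub>R dir (dir lpsi (0, h)) (0, h) (x, x)) \<le> C * norm h ^ 3"
    proof (rule taylor_second_order[OF smooth_lpsi])
      fix t :: real assume t: "0 \<le> t" "t \<le> 1"
      show "(x, x) + t *\<^sub>R (0, h) \<in> \<Omega>" using seg[OF t] r(2) by blast
      show "norm (dir (dir (dir lpsi (0, h)) (0, h)) (0, h) ((x, x) + t *\<^sub>R (0, h))) \<le> C * norm h ^ 3"
        using C[OF seg[OF t], of "(0, h)" "(0, h)" "(0, h)"] by (simp add: norm_Pair power3_eq_cube mult.assoc)
    qed
    then show "norm (lpsi (x, x + h) - h - (1 / 2) *\<^sub>R lQ x h h) \<le> C * norm h ^ 3"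
      using x K(2) by (simp add: lpsi_diag dir_lpsi_diag lQ_def subset_iff)
  qed
qed

text \<open>A logarithm agrees with the difference of coordinates up to second order, so either of the two
  increments of the path controls the other.\<close>

lemma log_first_order:
  assumes K: "compact K" "K \<subseteq> R"
  shows "\<exists>C\<ge>0. \<exists>r>0. \<forall>x\<in>K. \<forall>h. norm h \<le> r \<longrightarrow>
    norm (lpsi (x, x + h) - h) \<le> C * (norm h)\<^sup>2 \<and> norm h \<le> 2 * norm (lpsi (x, x + h))"
proof -
  obtain C r where C: "C \<ge> 0" "r > 0" "\<And>x h. x \<in> K \<Longrightarrow> norm h \<le> r \<Longrightarrow>
      norm (lpsi (x, x + h) - h - (1 / 2) *\<^sub>R lQ x h h) \<le> C * norm h ^ 3"
    using log_expansion[OF K] by blast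
  obtain B where B: "B \<ge> 0" "\<And>x u v. x \<in> K \<Longrightarrow> norm (lQ x u v) \<le> B * norm u * norm v"
    using lQ_bound[OF K] by blast
  \<comment> \<open>Inside radius \<open>r\<close> the cubic remainder is at most
    \<open>C * r\<close> times a square; \<open>B\<close> accounts for the quadratic term.\<close>
  define c where "c = C * r + B"
  have c: "c \<ge> 0" using B(1) C(1,2) by (simp add: c_def)
  have q: "norm (lpsi (x, x + h) - h) \<le> c * (norm h)\<^sup>2" if x: "x \<in> K" and h: "norm h \<le> r" for x h
  proof -
    have "norm (lpsi (x, x + h) - h) \<le> C * norm h ^ 3 + (1 / 2) * norm (lQ x h h)"
      using C(3)[OF x h] norm_triangle_sub[of "lpsi (x, x + h) - h" "(1 / 2) *\<^sub>R lQ x h h"] by simp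
    also have "C * norm h ^ 3 \<le> C * r * (norm h)\<^sup>2"
      using mult_left_mono[OF mult_right_mono[OF h zero_le_power2[of "norm h"]] C(1)]
      by (simp add: power3_eq_cube power2_eq_square mult.assoc)
    also have "(1 / 2) * norm (lQ x h h) \<le> B * (norm h)\<^sup>2"
      using B(2)[OF x, of h h] norm_ge_zero[of "lQ x h h"] by (simp only: power2_eq_square mult.assoc)
    finally show ?thesis by (simp add: c_def distrib_right)
  qed
  \<comment> \<open>So small that \<open>c * norm h \<le> 1 / 2\<close>, which makes the deviation
    at most half of \<open>norm h\<close>; \<open>c + 1\<close> avoids a zero denominator.\<close>
  define \<rho> where "\<rho> = min r (1 / (2 * (c + 1)))"
  have "norm h \<le> 2 * norm (lpsi (x, x + h))" if x: "x \<in> K" and h: "norm h \<le> \<rho>" for x h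
  proof -
    have "c * norm h \<le> (c + 1) * (1 / (2 * (c + 1)))"
      using h c by (intro mult_mono) (auto simp: \<rho>_def)
    also have "\<dots> = 1 / 2" using c by (simp add: field_simps)
    finally have "c * (norm h)\<^sup>2 \<le> 1 / 2 * norm h"
      using mult_right_mono[of "c * norm h" "1 / 2" "norm h"] by (simp add: power2_eq_square mult.assoc)
    moreover have "norm h \<le> norm (lpsi (x, x + h)) + norm (lpsi (x, x + h) - h)"
      by (metis norm_minus_commute norm_triangle_sub)
    moreover have "norm h \<le> r" using h by (simp add: \<rho>_def)
    note q[OF x this]
    ultimately show ?thesis by linarith
  qed
  moreover have "\<rho> > 0" "\<rho> \<le> r" using C(2) c by (auto simp: \<rho>_def)
  ultimately show ?thesis using q c by (meson order_trans)
qed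

end

text \<open>Converts Riemannian norms into coordinate norms: the metric attains a positive minimum
  on \<open>K\<close> times the unit sphere, and homogeneity does the rest. The empty
  \<open>K\<close> is split off because it arises when \<open>a > b\<close>.\<close>

lemma (in smooth_chart) riemannian_metric_lower_bound:
  assumes g: "riemannian_metric A g" and K: "compact K" "K \<subseteq> R"
  shows "\<exists>c>0. \<forall>x\<in>K. \<forall>e. c * norm e \<le> tnorm g (cinv \<phi> x) (ic (cinv \<phi> x) e)"
proof (cases "K = {}")
  case False
  let ?g = "\<lambda>x e e'. g (cinv \<phi> x) (ic (cinv \<phi> x) e) (ic (cinv \<phi> x) e')"
  have bil: "bilinear (?g x)" if "x \<in> R" for x
  proof -
    have "bilinear (g (cinv \<phi> x))" using g by (simp add: riemannian_metric_def)
    then show ?thesis using linear_ic[OF cinv_in[OF that]]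
      unfolding bilinear_def by (auto intro!: linear_compose[unfolded o_def, of "ic (cinv \<phi> x)"])
  qed
  have exp: "?g x e e = (\<Sum>(b, b')\<in>Basis \<times> Basis. (e \<bullet> b) * (e \<bullet> b') * ?g x b b')" if "x \<in> R" for x e
  proof -
    have "?g x (\<Sum>b\<in>Basis. (e \<bullet> b) *\<^sub>R b) (\<Sum>b\<in>Basis. (e \<bullet> b) *\<^sub>R b) =
        (\<Sum>(b, b')\<in>Basis \<times> Basis. ?g x ((e \<bullet> b) *\<^sub>R b) ((e \<bullet> b') *\<^sub>R b'))"
      by (rule bilinear_sum[OF bil[OF that]])
    then show ?thesis
      by (simp add: euclidean_representation bilinear_lmul[OF bil[OF that]] bilinear_rmul[OF bil[OF that]]
          mult.assoc mult.left_commute case_prod_unfold)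
  qed
  \<comment> \<open>Metric coefficients are known to be continuous for fixed vectors only; joint
    continuity comes from the basis expansion.\<close>
  have cont: "continuous_on (K \<times> sphere 0 1) (\<lambda>z. ?g (fst z) (snd z) (snd z))"
  proof -
    have "continuous_on K (\<lambda>x. ?g x b b')" for b b'
      using g chart_in K(2) unfolding riemannian_metric_def
      by (meson smooth_on_continuous_on continuous_on_subset)
    then have "continuous_on (K \<times> sphere 0 1)
        (\<lambda>z. \<Sum>(b, b')\<in>Basis \<times> Basis. (snd z \<bullet> b) * (snd z \<bullet> b') * ?g (fst z) b b')"
      unfolding case_prod_unfold
      by (intro continuous_on_sum continuous_on_mult continuous_on_inner continuous_intros
          continuous_on_compose2[of K "\<lambda>x. ?g x _ _" _ fst]) auto
    then show ?thesis
      by (rule continuous_on_cong[THEN iffD1, rotated 2]) (use exp K(2) in auto)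
  qed
  have "compact (K \<times> sphere (0::'e) 1)" "K \<times> sphere (0::'e) 1 \<noteq> {}"
    using K(1) False by (auto intro!: compact_Times)
  from continuous_attains_inf[OF this cont]
  obtain x0 e0 where x0: "x0 \<in> K" "norm e0 = 1"
    and min: "\<And>x e. x \<in> K \<Longrightarrow> norm e = 1 \<Longrightarrow> ?g x0 e0 e0 \<le> ?g x e e"
    by auto
  define \<mu> where "\<mu> = ?g x0 e0 e0"
  have "ic (cinv \<phi> x0) e0 \<noteq> 0"
    using x0 K(2) dc_ic[OF cinv_in, of x0 e0] linear_0[OF linear_dc[OF cinv_in], of x0] by auto
  then have \<mu>: "\<mu> > 0" using g by (simp add: \<mu>_def riemannian_metric_def)
  have "sqrt \<mu> * norm e \<le> tnorm g (cinv \<phi> x) (ic (cinv \<phi> x) e)" if x: "x \<in> K" for x e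
  proof (cases "e = 0")
    case True
    have "linear (?g x 0)" using bil[of x] x K(2) unfolding bilinear_def by blast
    from linear_0[OF this] show ?thesis using True by (simp add: tnorm_def)
  next
    case False
    let ?n = "norm e" and ?u = "(1 / norm e) *\<^sub>R e"
    have xR: "x \<in> R" using x K(2) by auto
    have "?g x (?n *\<^sub>R ?u) (?n *\<^sub>R ?u) = ?n * (?n * ?g x ?u ?u)"
      using bilinear_lmul[OF bil[OF xR], of ?n ?u "?n *\<^sub>R ?u"] bilinear_rmul[OF bil[OF xR], of ?u ?n ?u]
      by (simp only: real_scaleR_def)
    moreover have "?n *\<^sub>R ?u = e" "norm ?u = 1" using False by auto
    ultimately have "\<mu> * ?n\<^sup>2 \<le> ?g x e e"
      using min[OF x, of ?u] mult_left_mono[of \<mu> "?g x ?u ?u" "?n\<^sup>2"] by (simp add: \<mu>_def power2_eq_square mult_ac)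
    then have "sqrt (\<mu> * ?n\<^sup>2) \<le> sqrt (?g x e e)" by (rule real_sqrt_le_mono)
    then show ?thesis by (simp add: tnorm_def real_sqrt_mult)
  qed
  then show ?thesis using \<mu> by (intro exI[of _ "sqrt \<mu>"]) auto
qed (auto intro: exI[of _ 1])

section \<open>Increments of a controlled path in the chart\<close>

context smooth_chart
begin

text \<open>The conclusion mentions no gauge, so it can be combined with any other one. The
  parameter \<open>\<rho>\<close> lets increments be kept within the range of an expansion in that
  other gauge.\<close>

lemma crp_increments:
  fixes x :: "real \<Rightarrow> real ^ 'k"
  assumes \<omega>: "control T \<omega>" and rp: "weak_geometric_rough_path T p \<omega> x \<X>"
    and crp: "crp_manifold A T p \<omega> x y yd"
    and ab: "0 \<le> a" "b \<le> T" and dom: "y ` {a..b} \<subseteq> cdom \<phi>" and "0 < p" "0 < \<rho>"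
  shows "\<exists>C\<ge>0. \<exists>\<delta>>0. \<forall>s\<in>{a..b}. \<forall>t\<in>{a..b}. s \<le> t \<and> t - s \<le> \<delta> \<longrightarrow>
    norm (cfun \<phi> (y t) - cfun \<phi> (y s)) \<le> \<rho> \<and>
    norm (cfun \<phi> (y t) - cfun \<phi> (y s)) \<le> C * \<omega> s t powr (1 / p) \<and>
    norm (dc (y s) (yd s (x t - x s))) \<le> C * \<omega> s t powr (1 / p) \<and>
    norm (cfun \<phi> (y t) - cfun \<phi> (y s) - dc (y s) (yd s (x t - x s))) \<le> C * (\<omega> s t powr (1 / p))\<^sup>2"
proof -
  obtain \<D> \<psi> U g where G: "gauge_on A \<D> \<psi> U" "riemannian_metric A g"
    and ap: "approx_on {0..T} \<omega> p (\<lambda>s. tnorm g (y s)) 2 (\<lambda>s t. \<psi> (y s) (y t)) (\<lambda>s t. yd s (x t - x s))"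
    using crp unfolding crp_manifold_def by blast
  interpret chart_gauge A \<phi> \<D> \<psi> U by unfold_locales (rule G(1))
  define Y where "Y t = cfun \<phi> (y t)" for t
  define q where "q s t = \<omega> s t powr (1 / p)" for s t
  define H where "H s t = dc (y s) (yd s (x t - x s))" for s t
  have y_in: "y t \<in> cdom \<phi>" if "t \<in> {a..b}" for t using dom that by blast
  have T: "t \<in> {0..T}" if "t \<in> {a..b}" for t using ab that by auto
  have contY: "continuous_on {a..b} Y"
  proof -
    have "continuous_on {0..T} y" using crp by (simp add: crp_manifold_def)
    then have "continuous_on {a..b} y" by (rule continuous_on_subset) (use T in blast)
    from continuous_on_compose2[OF continuous_on_cfun this dom] show ?thesis by (simp add: Y_def[abs_def])
  qed
  define K where "K = Y ` {a..b}"
  have K: "compact K" "K \<subseteq> R"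
    using compact_continuous_image[OF contY] y_in by (auto simp: K_def Y_def)
  have YK: "Y s \<in> K" if "s \<in> {a..b}" for s using that by (simp add: K_def)
  \<comment> \<open>Continuity of \<open>yd\<close> in the chart is given vector by vector;
    \<open>bound_linear_family\<close> makes the bound uniform in \<open>w\<close>.\<close>
  obtain B where B: "B \<ge> 0" "\<And>s w. s \<in> {a..b} \<Longrightarrow> norm (dc (y s) (yd s w)) \<le> B * norm w"
  proof -
    have "\<exists>C\<ge>0. \<forall>s\<in>{a..b}. \<forall>w. norm (dc (y s) (yd s w)) \<le> C * norm w"
    proof (rule bound_linear_family)
      fix s assume "s \<in> {a..b}"
      then have "linear (dc (y s) \<circ> blinfun_apply (yd s))"
        by (intro linear_compose linear_dc y_in bounded_linear.linear[OF blinfun.bounded_linear_right])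
      then show "linear (\<lambda>w. dc (y s) (yd s w))" by (simp add: o_def)
    next
      fix w
      have "continuous_on {t \<in> {0..T}. y t \<in> cdom \<phi>} (\<lambda>t. dc (y t) (yd t w))"
        using crp chart_in unfolding crp_manifold_def by blast
      then have "continuous_on {a..b} (\<lambda>t. dc (y t) (yd t w))"
        by (rule continuous_on_subset) (use T y_in in auto)
      then show "bounded ((\<lambda>s. dc (y s) (yd s w)) ` {a..b})"
        by (intro compact_imp_bounded compact_continuous_image) auto
    qed
    with that show ?thesis by blast
  qed
  obtain c where c: "c > 0" "\<And>x e. x \<in> K \<Longrightarrow> c * norm e \<le> tnorm g (cinv \<phi> x) (ic (cinv \<phi> x) e)"
    using riemannian_metric_lower_bound[OF G(2) K] by blast
  obtain C1 r where C1: "C1 \<ge> 0" "r > 0" "\<And>x h. x \<in> K \<Longrightarrow> norm h \<le> r \<Longrightarrow>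
      norm (lpsi (x, x + h) - h) \<le> C1 * (norm h)\<^sup>2"
    "\<And>x h. x \<in> K \<Longrightarrow> norm h \<le> r \<Longrightarrow> norm h \<le> 2 * norm (lpsi (x, x + h))"
    using log_first_order[OF K] by blast
  obtain C0 \<delta>0 where C0: "\<delta>0 > 0" "\<And>s t. s \<in> {0..T} \<Longrightarrow> t \<in> {0..T} \<Longrightarrow> s \<le> t \<Longrightarrow> t - s \<le> \<delta>0 \<Longrightarrow>
      tnorm g (y s) (\<psi> (y s) (y t) - yd s (x t - x s)) \<le> C0 * (q s t)\<^sup>2"
    using ap unfolding approx_on_def powr_of_nat_div[of 2, OF zero_less_numeral] q_def by blast
  have "min \<rho> r > 0" using C1(2) \<open>0 < \<rho>\<close> by simp
  then obtain \<delta>1 where \<delta>1: "\<delta>1 > 0"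
    "\<And>s t. s \<in> {a..b} \<Longrightarrow> t \<in> {a..b} \<Longrightarrow> dist t s < \<delta>1 \<Longrightarrow> dist (Y t) (Y s) < min \<rho> r"
    using compact_uniformly_continuous[OF contY compact_Icc] unfolding uniformly_continuous_on_def by metis
  \<comment> \<open>The bound on \<open>t - s\<close> is not strict, while uniform continuity asks
    for a strict one; hence the half.\<close>
  define \<delta> where "\<delta> = min \<delta>0 (\<delta>1 / 2)"
  define M where "M = \<omega> 0 T powr (1 / p)"
  \<comment> \<open>\<open>E\<close> is the constant of the gauge estimate after passing to
    coordinates, \<open>D\<close> that of the coordinate increment: its factor 2 comes from
    \<open>log_first_order\<close>, and \<open>M\<close> trades a square of \<open>q\<close> for
    \<open>q\<close>. \<open>C\<close> exceeds every constant needed in the conclusion.\<close>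
  define E where "E = \<bar>C0\<bar> / c"
  define D where "D = 2 * (B + E * M)"
  have pos: "E \<ge> 0" "M \<ge> 0" "D \<ge> 0" using c(1) B(1) by (auto simp: E_def M_def D_def)
  define C where "C = B + D + (E + C1 * D\<^sup>2)"
  have main: "norm (Y t - Y s) \<le> \<rho> \<and> norm (Y t - Y s) \<le> C * q s t \<and>
      norm (H s t) \<le> C * q s t \<and> norm (Y t - Y s - H s t) \<le> C * (q s t)\<^sup>2"
    if st: "s \<in> {a..b}" "t \<in> {a..b}" "s \<le> t" "t - s \<le> \<delta>" for s t
  proof -
    let ?h = "Y t - Y s"
    have \<delta>: "t - s \<le> \<delta>0" "dist t s < \<delta>1" using st \<delta>1(1) by (auto simp: \<delta>_def dist_real_def)
    have h: "norm ?h \<le> \<rho>" "norm ?h \<le> r" using \<delta>1(2)[OF st(1,2) \<delta>(2)] by (auto simp: dist_norm)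
    have bounds: "0 \<le> q s t" "q s t \<le> M"
      using control_le[OF \<omega>, of s t] st T \<open>0 < p\<close>
      by (auto simp: q_def M_def intro!: powr_mono2)
    have "(s, t) \<in> simplex_upto T" using st T by (auto simp: simplex_upto_def)
    then have x: "norm (x t - x s) \<le> q s t"
      using rp unfolding weak_geometric_rough_path_def q_def by blast
    have H: "norm (H s t) \<le> B * q s t"
      unfolding H_def by (rule order_trans[OF B(2)[OF st(1)] mult_left_mono[OF x B(1)]])
    have eq: "lpsi (Y s, Y t) - H s t = dc (y s) (\<psi> (y s) (y t) - yd s (x t - x s))"
      using y_in st by (simp add: lpsi_def Y_def cinv_cfun H_def linear_diff[OF linear_dc])
    have log: "norm (lpsi (Y s, Y t) - H s t) \<le> E * (q s t)\<^sup>2"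
    proof -
      have "c * norm (lpsi (Y s, Y t) - H s t) \<le> tnorm g (y s) (\<psi> (y s) (y t) - yd s (x t - x s))"
        unfolding eq using c(2)[OF YK[OF st(1)], of "dc (y s) (\<psi> (y s) (y t) - yd s (x t - x s))"] y_in[OF st(1)]
        by (simp add: Y_def cinv_cfun ic_dc)
      also have "\<dots> \<le> \<bar>C0\<bar> * (q s t)\<^sup>2"
        using C0(2)[OF T[OF st(1)] T[OF st(2)] st(3) \<delta>(1)]
        by (rule order_trans) (intro mult_right_mono, auto)
      finally show ?thesis using c(1) by (simp add: E_def field_simps)
    qed
    have q2: "(q s t)\<^sup>2 \<le> M * q s t"
      unfolding power2_eq_square using bounds by (intro mult_right_mono) auto
    have "norm ?h \<le> 2 * norm (lpsi (Y s, Y t))"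
      using C1(4)[OF YK[OF st(1)] h(2)] by simp
    also have "norm (lpsi (Y s, Y t)) \<le> E * (q s t)\<^sup>2 + B * q s t"
      using log H norm_triangle_sub[of "lpsi (Y s, Y t)" "H s t"] by linarith
    also have "E * (q s t)\<^sup>2 \<le> E * (M * q s t)" by (rule mult_left_mono[OF q2 pos(1)])
    finally have hD: "norm ?h \<le> D * q s t" by (simp add: D_def algebra_simps)
    \<comment> \<open>With \<open>hD\<close> available, the quadratic deviation of the logarithm
      from \<open>?h\<close> is of order \<open>q^2\<close>, as is its distance from
      \<open>H s t\<close>.\<close>
    have "norm (?h - H s t) \<le> norm (lpsi (Y s, Y t) - H s t) + norm (lpsi (Y s, Y t) - ?h)"
      using norm_triangle_ineq4[of "lpsi (Y s, Y t) - H s t" "lpsi (Y s, Y t) - ?h"]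
      by (simp add: algebra_simps)
    also have "norm (lpsi (Y s, Y t) - ?h) \<le> C1 * (norm ?h)\<^sup>2"
      using C1(3)[OF YK[OF st(1)] h(2)] by simp
    also have "\<dots> \<le> C1 * (D * q s t)\<^sup>2"
      by (intro mult_left_mono power_mono hD C1(1) norm_ge_zero)
    finally have hH: "norm (?h - H s t) \<le> (E + C1 * D\<^sup>2) * (q s t)\<^sup>2"
      using log by (simp add: algebra_simps power_mult_distrib)
    have "D * q s t \<le> C * q s t" "B * q s t \<le> C * q s t" "(E + C1 * D\<^sup>2) * (q s t)\<^sup>2 \<le> C * (q s t)\<^sup>2"
      using pos B(1) C1(1) bounds(1) by (auto simp: C_def intro!: mult_right_mono)
    with h(1) H hD hH show ?thesis by linarith
  qed
  have "C \<ge> 0" using pos B(1) C1(1) by (simp add: C_def)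
  moreover have "\<delta> > 0" using C0(1) \<delta>1(1) by (simp add: \<delta>_def)
  ultimately show ?thesis using main unfolding Y_def H_def q_def by blast
qed

end

section \<open>Comparison of the gauge and chart expansions\<close>

context chart_gauge
begin

text \<open>In the application \<open>u\<close> is the increment of \<open>x\<close>, so
  \<open>dc m (B u)\<close> is the vector to be compared with the coordinate increment.\<close>

lemma lQ_tensor_eval:
  assumes m: "m \<in> cdom \<phi>" and X: "(1 / 2) *\<^sub>R (X + transpose X) = (1 / 2) *\<^sub>R tensor2 u u"
  shows "tensor_eval (\<lambda>v w. coform \<alpha> (lQ (cfun \<phi> m) (dc m v) (dc m w)) (cfun \<phi> m)) B X =
    coform \<alpha> ((1 / 2) *\<^sub>R lQ (cfun \<phi> m) (dc m (B u)) (dc m (B u))) (cfun \<phi> m)"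
proof -
  let ?x = "cfun \<phi> m"
  have x: "?x \<in> R" using m by simp
  let ?b = "\<lambda>v w. coform \<alpha> (lQ ?x (dc m v) (dc m w)) ?x"
  note lc = linear_coform[OF x, of \<alpha>] and ld = linear_dc[OF m]
  have "linear (lQ ?x v)" "linear (\<lambda>v. lQ ?x v w)" for v w
    using bilinear_lQ[OF x] by (auto simp: bilinear_def)
  then have "bilinear ?b"
    using linear_compose[OF linear_compose[OF ld] lc] unfolding bilinear_def o_def by blast
  from tensor_eval_symmetric[OF this _ X] show ?thesis
    by (simp add: lQ_commute[OF x] linear_scale[OF linear_coform[OF x]])
qed

text \<open>An exact identity at two fixed points, with no smallness involved: linearity of
  \<open>\<alpha>\<close> at \<open>m\<close> gathers everything into a single vector, leaving one
  estimate for the logarithm.\<close>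

lemma gauge_expansion_minus_chart_expansion:
  fixes \<alpha> :: "'m \<Rightarrow> 'e \<Rightarrow>\<^sub>L 'v::real_normed_vector"
  assumes \<alpha>: "smooth_one_form A \<alpha>" and m: "m \<in> cdom \<phi>" "n \<in> cdom \<phi>"
    and X: "(1 / 2) *\<^sub>R (X + transpose X) = (1 / 2) *\<^sub>R tensor2 u u"
  shows "(\<alpha> m (\<psi> m n) + tensor_eval (\<lambda>v w. nabla_form A U \<alpha> m v w + \<alpha> m (compat_tensor A \<psi> U m v w)) B X)
    - (\<alpha> m (ic m (cfun \<phi> n - cfun \<phi> m)) + tensor_eval (\<lambda>v w. tderiv A (\<lambda>n. \<alpha> n (ic n (dc m w))) m v) B X)
    = coform \<alpha> (lpsi (cfun \<phi> m, cfun \<phi> n) - (cfun \<phi> n - cfun \<phi> m)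
        - (1 / 2) *\<^sub>R lQ (cfun \<phi> m) (dc m (B u)) (dc m (B u))) (cfun \<phi> m)"
proof -
  have x: "cfun \<phi> m \<in> R" using m by simp
  have "\<alpha> m (\<psi> m n) = coform \<alpha> (lpsi (cfun \<phi> m, cfun \<phi> n)) (cfun \<phi> m)"
    by (simp add: coform_cfun m psi_eq)
  then show ?thesis
    unfolding nabla_form_plus_compat_tensor[OF \<alpha> m(1)] tensor_eval_diff
      lQ_tensor_eval[OF m(1) X, unfolded lQ_def, of \<alpha> B]
    by (simp add: coform_cfun[OF m(1), symmetric] linear_diff[OF linear_coform[OF x]] lQ_def)
qed

lemma coform_bound:
  fixes \<alpha> :: "'m \<Rightarrow> 'e \<Rightarrow>\<^sub>L 'v::real_normed_vector"
  assumes "smooth_one_form A \<alpha>" "compact K" "K \<subseteq> R"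
  shows "\<exists>C\<ge>0. \<forall>x\<in>K. \<forall>e. norm (coform \<alpha> e x) \<le> C * norm e"
proof (rule bound_linear_family)
  show "linear (\<lambda>e. coform \<alpha> e x)" if "x \<in> K" for x
    using linear_coform assms(3) that by blast
  show "bounded ((\<lambda>x. coform \<alpha> b x) ` K)" for b
    by (intro compact_imp_bounded compact_continuous_image assms(2)
        continuous_on_subset[OF smooth_on_continuous_on[OF smooth_on_coform[OF assms(1)]] assms(3)])
qed

text \<open>By symmetry, \<open>Q(h, h) - Q(k, k) = Q(h - k, h + k)\<close> for the second derivative \<open>Q\<close> of the logarithm.\<close>

lemma log_remainder:
  assumes K: "compact K" "K \<subseteq> R"
  shows "\<exists>C\<ge>0. \<exists>r>0. \<forall>x\<in>K. \<forall>h k c q. 0 \<le> q \<and> 0 \<le> c \<and> norm h \<le> r \<and> norm h \<le> c * q \<and> norm k \<le> c * q \<and>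
      norm (h - k) \<le> c * q\<^sup>2 \<longrightarrow>
    norm (lpsi (x, x + h) - h - (1 / 2) *\<^sub>R lQ x k k) \<le> C * (c ^ 3 + c\<^sup>2) * q ^ 3"
proof -
  obtain C r where C: "C \<ge> 0" "r > 0" "\<And>x h. x \<in> K \<Longrightarrow> norm h \<le> r \<Longrightarrow>
      norm (lpsi (x, x + h) - h - (1 / 2) *\<^sub>R lQ x h h) \<le> C * norm h ^ 3"
    using log_expansion[OF K] by blast
  obtain B where B: "B \<ge> 0" "\<And>x u v. x \<in> K \<Longrightarrow> norm (lQ x u v) \<le> B * norm u * norm v"
    using lQ_bound[OF K] by blast
  \<comment> \<open>\<open>C * c ^ 3\<close> comes from the cubic Taylor remainder at
    \<open>h\<close>; \<open>B * c\<^sup>2\<close> is half of \<open>B\<close> times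
    \<open>c * q\<^sup>2\<close> for \<open>h - k\<close> times \<open>2 * c * q\<close> for
    \<open>h + k\<close>, cleared of its powers of \<open>q\<close>.\<close>
  have "norm (lpsi (x, x + h) - h - (1 / 2) *\<^sub>R lQ x k k) \<le> (C + B) * (c ^ 3 + c\<^sup>2) * q ^ 3"
    if x: "x \<in> K" and q: "0 \<le> q" "0 \<le> c" and h: "norm h \<le> r" "norm h \<le> c * q" and k: "norm k \<le> c * q"
      and hk: "norm (h - k) \<le> c * q\<^sup>2" for x h k c q
  proof -
    have xR: "x \<in> R" using x K(2) by blast
    note bil = bilinear_lQ[OF xR]
    have "lQ x (h - k) (h + k) = lQ x h h - lQ x k k"
      by (simp add: bilinear_lsub[OF bil] bilinear_radd[OF bil] lQ_commute[OF xR, of k h])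
    then have "norm (lQ x h h - lQ x k k) \<le> B * norm (h - k) * norm (h + k)"
      using B(2)[OF x, of "h - k" "h + k"] by simp
    also have "\<dots> \<le> B * (c * q\<^sup>2) * (2 * (c * q))"
      using hk h(2) k q B(1) norm_triangle_ineq[of h k]
      by (intro mult_mono mult_nonneg_nonneg order_refl) auto
    finally have 1: "norm ((1 / 2) *\<^sub>R (lQ x h h - lQ x k k)) \<le> B * c\<^sup>2 * q ^ 3"
      by (simp add: power2_eq_square power3_eq_cube mult_ac)
    have "norm h ^ 3 \<le> (c * q) ^ 3" using h(2) by (intro power_mono) auto
    then have "C * norm h ^ 3 \<le> C * (c ^ 3 * q ^ 3)"
      unfolding power_mult_distrib by (rule mult_left_mono[OF _ C(1)])
    with C(3)[OF x h(1)] have 2: "norm (lpsi (x, x + h) - h - (1 / 2) *\<^sub>R lQ x h h) \<le> C * (c ^ 3 * q ^ 3)"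
      by linarith
    have "norm (lpsi (x, x + h) - h - (1 / 2) *\<^sub>R lQ x k k) \<le> C * (c ^ 3 * q ^ 3) + B * c\<^sup>2 * q ^ 3"
      using norm_triangle_mono[OF 2 1] by (simp add: algebra_simps)
    also have "\<dots> \<le> (C + B) * (c ^ 3 + c\<^sup>2) * q ^ 3"
      using C(1) B(1) q by (simp add: algebra_simps)
    finally show ?thesis .
  qed
  then show ?thesis using C(1,2) B(1)
    by - (rule exI[of _ "C + B"], rule conjI, simp, rule exI[of _ r], simp)
qed

end

theorem corollary4p7:
  fixes T p a b :: real
    and \<omega> :: "real \<Rightarrow> real \<Rightarrow> real"
    and x :: "real \<Rightarrow> real ^ 'k" and \<X> :: "real \<Rightarrow> real \<Rightarrow> real ^ 'k ^ 'k"
    and A :: "('m::{t2_space,second_countable_topology}, 'e::euclidean_space) chart set"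
    and y :: "real \<Rightarrow> 'm" and yd :: "real \<Rightarrow> (real ^ 'k) \<Rightarrow>\<^sub>L 'e"
    and \<alpha> :: "'m \<Rightarrow> 'e \<Rightarrow>\<^sub>L 'v::banach"
    and z :: "real \<Rightarrow> 'v" and zd :: "real \<Rightarrow> (real ^ 'k) \<Rightarrow>\<^sub>L 'v"
    and \<phi> :: "('m, 'e) chart"
  assumes "0 < T" and "1 \<le> p" and "p < 3"
    and "control T \<omega>"
    and "weak_geometric_rough_path T p \<omega> x \<X>"
    and "smooth_structure A"
    and "crp_manifold A T p \<omega> x y yd"
    and "smooth_one_form A \<alpha>"
    and "has_rough_integral A T p \<omega> x \<X> y yd \<alpha> z zd"
    and "\<phi> \<in> A"
    and "a \<in> {0..T}" and "b \<in> {0..T}"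
    and "y ` {a..b} \<subseteq> cdom \<phi>"
  shows "approx_on {a..b} \<omega> p (\<lambda>s. norm) 3
    (\<lambda>s t. z t - z s)
    (\<lambda>s t. \<alpha> (y s) (inv (tderiv A (cfun \<phi>) (y s)) (cfun \<phi> (y t) - cfun \<phi> (y s))) +
       tensor_eval
         (\<lambda>v w. tderiv A
            (\<lambda>m. \<alpha> m (inv (tderiv A (cfun \<phi>) m) (tderiv A (cfun \<phi>) (y s) w))) (y s) v)
         (yd s) (\<X> s t))"
proof -
  note \<omega> = assms(4) and rp = assms(5) and crp = assms(7) and \<alpha> = assms(8) and dom = assms(13)
  have ab: "0 \<le> a" "b \<le> T" and p: "0 < p" using assms(2,11,12) by auto
  obtain \<D> \<psi> U where G: "gauge_on A \<D> \<psi> U"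
    and ap: "approx_on {0..T} \<omega> p (\<lambda>s. norm) 3 (\<lambda>s t. z t - z s)
          (\<lambda>s t. \<alpha> (y s) (\<psi> (y s) (y t)) +
             tensor_eval (\<lambda>v w. nabla_form A U \<alpha> (y s) v w + \<alpha> (y s) (compat_tensor A \<psi> U (y s) v w))
               (yd s) (\<X> s t))" (is "approx_on _ _ _ _ _ _ ?F")
    using assms(9) unfolding has_rough_integral_def by blast
  interpret chart_gauge A \<phi> \<D> \<psi> U by unfold_locales (fact assms(6) assms(10) G)+
  let ?G = "\<lambda>s t. \<alpha> (y s) (ic (y s) (cfun \<phi> (y t) - cfun \<phi> (y s))) +
       tensor_eval (\<lambda>v w. tderiv A (\<lambda>m. \<alpha> m (ic m (dc (y s) w))) (y s) v) (yd s) (\<X> s t)"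
  define Y where "Y t = cfun \<phi> (y t)" for t
  define q where "q s t = \<omega> s t powr (1 / p)" for s t
  have T: "t \<in> {0..T}" if "t \<in> {a..b}" for t using ab that by auto
  define K where "K = Y ` {a..b}"
  have "continuous_on {0..T} y" using crp by (simp add: crp_manifold_def)
  then have "continuous_on {a..b} y" by (rule continuous_on_subset) (use T in blast)
  from continuous_on_compose2[OF continuous_on_cfun this dom]
  have K: "compact K" "K \<subseteq> R" using dom
    by (auto simp: K_def Y_def[abs_def] intro: compact_continuous_image)
  obtain C1 where C1: "C1 \<ge> 0" "\<And>x e. x \<in> K \<Longrightarrow> norm (coform \<alpha> e x) \<le> C1 * norm e"
    using coform_bound[OF \<alpha> K] by blast
  obtain C2 r where C2: "C2 \<ge> 0" "r > 0"
    "\<And>x h k c q. x \<in> K \<Longrightarrow> 0 \<le> q \<Longrightarrow> 0 \<le> c \<Longrightarrow> norm h \<le> r \<Longrightarrow> norm h \<le> c * q \<Longrightarrow> norm k \<le> c * q \<Longrightarrow>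
      norm (h - k) \<le> c * q\<^sup>2 \<Longrightarrow>
      norm (lpsi (x, x + h) - h - (1 / 2) *\<^sub>R lQ x k k) \<le> C2 * (c ^ 3 + c\<^sup>2) * q ^ 3"
    using log_remainder[OF K] by blast
  \<comment> \<open>The radius \<open>r\<close> belongs to the gauge of the integral;
    \<open>crp_increments\<close> meets it while working with the gauge of the path.\<close>
  obtain c \<delta>1 where c: "c \<ge> 0" "\<delta>1 > 0" and incr: "\<And>s t. s \<in> {a..b} \<Longrightarrow> t \<in> {a..b} \<Longrightarrow> s \<le> t \<Longrightarrow> t - s \<le> \<delta>1 \<Longrightarrow>
      norm (Y t - Y s) \<le> r \<and> norm (Y t - Y s) \<le> c * q s t \<and>
      norm (dc (y s) (yd s (x t - x s))) \<le> c * q s t \<and>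
      norm (Y t - Y s - dc (y s) (yd s (x t - x s))) \<le> c * (q s t)\<^sup>2"
    using crp_increments[OF \<omega> rp crp ab dom p C2(2)] unfolding Y_def q_def by blast
  obtain C0 \<delta>0 where C0: "\<delta>0 > 0" "\<And>s t. s \<in> {0..T} \<Longrightarrow> t \<in> {0..T} \<Longrightarrow> s \<le> t \<Longrightarrow> t - s \<le> \<delta>0 \<Longrightarrow>
      norm (z t - z s - ?F s t) \<le> C0 * q s t ^ 3"
    using ap unfolding approx_on_def powr_of_nat_div[of 3, OF zero_less_numeral] q_def by blast
  \<comment> \<open>Stated for arbitrary vectors, so that the cancellation applies without rewriting
    inside the long terms \<open>?F\<close> and \<open>?G\<close>.\<close>
  have telescope: "d - f + (f - g) = d - g" for d f g :: 'v by simp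
  let ?C = "C1 * (C2 * (c ^ 3 + c\<^sup>2))"
  have "norm (z t - z s - ?G s t) \<le> (C0 + ?C) * q s t ^ 3"
    if st: "s \<in> {a..b}" "t \<in> {a..b}" "s \<le> t" "t - s \<le> min \<delta>0 \<delta>1" for s t
  proof -
    have in_dom: "y s \<in> cdom \<phi>" "y t \<in> cdom \<phi>" using dom st by auto
    have "(s, t) \<in> simplex_upto T" using st T by (auto simp: simplex_upto_def)
    then have X: "(1 / 2) *\<^sub>R (\<X> s t + transpose (\<X> s t)) = (1 / 2) *\<^sub>R tensor2 (x t - x s) (x t - x s)"
      using rp unfolding weak_geometric_rough_path_def by blast
    let ?h = "Y t - Y s" and ?k = "dc (y s) (yd s (x t - x s))"
    have "?F s t - ?G s t = coform \<alpha> (lpsi (Y s, Y t) - ?h - (1 / 2) *\<^sub>R lQ (Y s) ?k ?k) (Y s)"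
      unfolding Y_def by (rule gauge_expansion_minus_chart_expansion[OF \<alpha> in_dom X])
    also have "norm \<dots> \<le> C1 * norm (lpsi (Y s, Y t) - ?h - (1 / 2) *\<^sub>R lQ (Y s) ?k ?k)"
      by (rule C1(2)) (use st in \<open>simp add: K_def\<close>)
    also have "\<dots> \<le> C1 * (C2 * (c ^ 3 + c\<^sup>2) * q s t ^ 3)"
    proof (rule mult_left_mono[OF _ C1(1)])
      have "Y s \<in> K" "0 \<le> q s t" using st by (auto simp: K_def q_def)
      then show "norm (lpsi (Y s, Y t) - ?h - (1 / 2) *\<^sub>R lQ (Y s) ?k ?k) \<le> C2 * (c ^ 3 + c\<^sup>2) * q s t ^ 3"
        using C2(3)[of "Y s" "q s t" c ?h ?k] incr[OF st(1-3)] st(4) c(1) by simp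
    qed
    finally have "norm (?F s t - ?G s t) \<le> ?C * q s t ^ 3" by (simp add: mult.assoc)
    moreover have "norm (z t - z s - ?F s t) \<le> C0 * q s t ^ 3"
      using C0(2)[OF T[OF st(1)] T[OF st(2)] st(3)] st(4) by simp
    ultimately have "norm ((z t - z s - ?F s t) + (?F s t - ?G s t)) \<le> C0 * q s t ^ 3 + ?C * q s t ^ 3"
      by (rule norm_triangle_mono[rotated])
    moreover have "(z t - z s - ?F s t) + (?F s t - ?G s t) = z t - z s - ?G s t"
      by (rule telescope)
    ultimately show ?thesis by (simp only: distrib_right)
  qed
  moreover have "min \<delta>0 \<delta>1 > 0" using C0(1) c(2) by simp
  ultimately show ?thesis
    unfolding approx_on_def powr_of_nat_div[of 3, OF zero_less_numeral] q_def by blast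
qed

end
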